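(* Let $E$ be a finite directed graph with no sources. Let $(G,E)$ be a contracting, regular self-similar groupoid action with limit space $\mathcal{J}$, and let $\sigma:E^{-\infty}\to E^{-\infty}$ be the shift map. Then there is a surjective map $\tilde\sigma:\mathcal{J}\to\mathcal{J}$ such that $\tilde\sigma([x])=[\sigma(x)]$ for all $x\in E^{-\infty}$. Furthermore, there exist $\varepsilon>0$, $c>1$ and a metric $d_{\mathcal{J}}$ on $\mathcal{J}$ (inducing the quotient topology) such that (1) whenever $d_{\mathcal{J}}([x],[y])<\varepsilon$, we have $d_{\mathcal{J}}(\tilde\sigma([x]),\tilde\sigma([y]))=c\cdot d_{\mathcal{J}}([x],[y])$, and (2) whenever $0<\alpha\le\varepsilon$ and $[x]\in\mathcal{J}$, we have $\tilde\sigma(B([x],\alpha))=B(\tilde\sigma([x]),c\alpha)$, where $B(\cdot,\cdot)$ denotes open balls for $d_{\mathcal{J}}$. In particular, $\tilde\sigma$ is a locally expanding local homeomorphism.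
   Context: **Graphs.** A directed graph is $E=(E^0,E^1,r,s)$ with $r,s:E^1\to E^0$. Paths are $\mu=e_1\cdots e_n$ with $s(e_i)=r(e_{i+1})$; $r(\mu)=r(e_1)$, $s(\mu)=s(e_n)$; $E^n$ is the set of paths of length $n$, $E^*=\bigcup_nE^n$; $vE^*$, $vE^n$ denote the paths with range $v$. No sources: $vE^1\ne\emptyset$ for all $v\in E^0$. $E^\infty$ is the set of right-infinite paths $e_1e_2\cdots$ and $E^{-\infty}$ the set of left-infinite paths $\cdots e_{-2}e_{-1}$ (always $s(e_i)=r(e_{i+1})$), with the topologies generated by cylinder sets (fixing $e_1\cdots e_n$, respectively $e_{-n}\cdots e_{-1}$). **Self-similar groupoid actions.** A partial isomorphism of $E^*$ is a length-preserving bijection $g:vE^*\to wE^*$ with $g(\mu e)\in g(\mu)E^1$ whenever $\mu e\in vE^*$, $e\in E^1$; $d(g)=v$, $c(g)=w$. These form a groupoid $\mathrm{PIso}(E^* )$ under composition with unit space identified with $E^0$. A self-similar groupoid action $(G,E)$ is a groupoid $G$ with unit space $E^0$ and an injective homomorphism $G\to\mathrm{PIso}(E^* )$, identity on $E^0$ (written $g\cdot\mu$), such that for all $g\in G$, $e\in d(g)E^1$ there is a (necessarily unique) $g|_e\in G$ with $d(g|_e)=s(e)$, $c(g|_e)=s(g\cdot e)$, $g\cdot(e\mu)=(g\cdot e)(g|_e\cdot\mu)$ for all $\mu\in s(e)E^*$. Put $g|_{d(g)}=g$, $g|_{e\mu}=(g|_e)|_\mu$. $G$ acts on $E^\infty$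 via initial segments. Contracting: there is a finite $F\subseteq G$ such that for every $g\in G$ there is $n\ge0$ with $\{g|_\mu:\mu\in d(g)E^n\}\subseteq F$. Regular: whenever $g\cdot y=y$ with $g\in G$, $y\in E^\infty$, $r(y)=d(g)$, some initial segment $\mu$ of $y$ has $g\cdot\mu=\mu$ and $g|_\mu=s(\mu)$. **Limit space.** For $x,y\in E^{-\infty}$, $x\sim_{ae}y$ if there is a sequence $(g_n)_{n<0}$ in $G$ taking finitely many values with $g_n\cdot(x_n\cdots x_{-1})=y_n\cdots y_{-1}$ for all $n<0$. This is an equivalence relation; $\mathcal{J}=E^{-\infty}/{\sim_{ae}}$ with the quotient topology, and $[x]$ denotes the class of $x$. The shift map is $\sigma(\cdots x_{-3}x_{-2}x_{-1})=\cdots x_{-3}x_{-2}$. *)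

theory Defs
  imports "HOL-Analysis.Analysis" "Graph_Theory.Digraph"
begin

section \<open>Graphs and finite paths\<close>

text \<open>
  A directed graph \<open>(E\<^sup>0, E\<^sup>1, r, s)\<close> is a \<^typ>\<open>('v, 'e) pre_digraph\<close> satisfying
  \<^const>\<open>wf_digraph\<close>, with \<open>r\<close> = \<^const>\<open>head\<close> and \<open>s\<close> = \<^const>\<open>tail\<close>. Loops and parallel edges
  are allowed. Paths run against the edges: in \<open>e\<^sub>1 e\<^sub>2 \<dots> e\<^sub>n\<close> we have \<open>s(e\<^sub>i) = r(e\<^sub>i\<^sub>+\<^sub>1)\<close>.
\<close>

definition no_sources :: "('v, 'e) pre_digraph \<Rightarrow> bool" where
  "no_sources E \<longleftrightarrow> (\<forall>v\<in>verts E. \<exists>e\<in>arcs E. head E e = v)"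

text \<open>
  A finite path is its range together with its list of edges, so that the paths of length
  \<open>0\<close> are exactly the pairs \<open>(v, [])\<close> and remain distinct for distinct vertices.
\<close>

type_synonym ('v, 'e) fpath = "'v \<times> 'e list"

fun is_fpath :: "('v, 'e) pre_digraph \<Rightarrow> 'v \<Rightarrow> 'e list \<Rightarrow> bool" where
  "is_fpath E v [] \<longleftrightarrow> v \<in> verts E"
| "is_fpath E v (e # es) \<longleftrightarrow> e \<in> arcs E \<and> head E e = v \<and> is_fpath E (tail E e) es"

text \<open>The set \<open>vE\<^sup>*\<close> of finite paths with range \<open>v\<close>.\<close>

definition fpaths :: "('v, 'e) pre_digraph \<Rightarrow> 'v \<Rightarrow> ('v, 'e) fpath set" where
  "fpaths E v = {(v, es) | es. is_fpath E v es}"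

definition plen :: "('v, 'e) fpath \<Rightarrow> nat" where
  "plen \<mu> = length (snd \<mu>)"

definition psource :: "('v, 'e) pre_digraph \<Rightarrow> ('v, 'e) fpath \<Rightarrow> 'v" where
  "psource E \<mu> = (if snd \<mu> = [] then fst \<mu> else tail E (last (snd \<mu>)))"

definition pcat :: "('v, 'e) fpath \<Rightarrow> ('v, 'e) fpath \<Rightarrow> ('v, 'e) fpath" where
  "pcat \<mu> \<nu> = (fst \<mu>, snd \<mu> @ snd \<nu>)"

definition pedge :: "('v, 'e) pre_digraph \<Rightarrow> 'e \<Rightarrow> ('v, 'e) fpath" where
  "pedge E e = (head E e, [e])"

section \<open>Groupoids and partial isomorphisms\<close>

text \<open>
  The field \<open>gone\<close> is the identification of the unit space \<open>gunits\<close> with the set of identity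
  arrows. The product \<open>gmult G g h\<close> is meaningful when \<open>gdom G g = gcod G h\<close>.
\<close>

record ('v, 'g) groupoid =
  gunits :: "'v set"
  garrows :: "'g set"
  gdom :: "'g \<Rightarrow> 'v"
  gcod :: "'g \<Rightarrow> 'v"
  gone :: "'v \<Rightarrow> 'g"
  gmult :: "'g \<Rightarrow> 'g \<Rightarrow> 'g"
  ginv :: "'g \<Rightarrow> 'g"

locale groupoid =
  fixes G :: "('v, 'g) groupoid"
  assumes gdom_closed: "g \<in> garrows G \<Longrightarrow> gdom G g \<in> gunits G"
    and gcod_closed: "g \<in> garrows G \<Longrightarrow> gcod G g \<in> gunits G"
    and gone_closed: "v \<in> gunits G \<Longrightarrow> gone G v \<in> garrows G"
    and gdom_gone: "v \<in> gunits G \<Longrightarrow> gdom G (gone G v) = v"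
    and gcod_gone: "v \<in> gunits G \<Longrightarrow> gcod G (gone G v) = v"
    and gmult_closed:
      "\<lbrakk>g \<in> garrows G; h \<in> garrows G; gdom G g = gcod G h\<rbrakk> \<Longrightarrow> gmult G g h \<in> garrows G"
    and gdom_gmult:
      "\<lbrakk>g \<in> garrows G; h \<in> garrows G; gdom G g = gcod G h\<rbrakk> \<Longrightarrow> gdom G (gmult G g h) = gdom G h"
    and gcod_gmult:
      "\<lbrakk>g \<in> garrows G; h \<in> garrows G; gdom G g = gcod G h\<rbrakk> \<Longrightarrow> gcod G (gmult G g h) = gcod G g"
    and gmult_assoc:
      "\<lbrakk>g \<in> garrows G; h \<in> garrows G; k \<in> garrows G; gdom G g = gcod G h; gdom G h = gcod G k\<rbrakk>
        \<Longrightarrow> gmult G (gmult G g h) k = gmult G g (gmult G h k)"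
    and gmult_gone_right: "g \<in> garrows G \<Longrightarrow> gmult G g (gone G (gdom G g)) = g"
    and gmult_gone_left: "g \<in> garrows G \<Longrightarrow> gmult G (gone G (gcod G g)) g = g"
    and ginv_closed: "g \<in> garrows G \<Longrightarrow> ginv G g \<in> garrows G"
    and gdom_ginv: "g \<in> garrows G \<Longrightarrow> gdom G (ginv G g) = gcod G g"
    and gcod_ginv: "g \<in> garrows G \<Longrightarrow> gcod G (ginv G g) = gdom G g"
    and gmult_ginv_left: "g \<in> garrows G \<Longrightarrow> gmult G (ginv G g) g = gone G (gdom G g)"
    and gmult_ginv_right: "g \<in> garrows G \<Longrightarrow> gmult G g (ginv G g) = gone G (gcod G g)"

text \<open>Homomorphisms of groupoids with the same unit space that are the identity on units.\<close>

definition unital_groupoid_hom ::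
    "('v, 'g) groupoid \<Rightarrow> ('v, 'h) groupoid \<Rightarrow> ('g \<Rightarrow> 'h) \<Rightarrow> bool" where
  "unital_groupoid_hom G H \<phi> \<longleftrightarrow>
     gunits G = gunits H \<and>
     (\<forall>g\<in>garrows G. \<phi> g \<in> garrows H \<and> gdom H (\<phi> g) = gdom G g \<and> gcod H (\<phi> g) = gcod G g) \<and>
     (\<forall>v\<in>gunits G. \<phi> (gone G v) = gone H v) \<and>
     (\<forall>g\<in>garrows G. \<forall>h\<in>garrows G. gdom G g = gcod G h \<longrightarrow>
        \<phi> (gmult G g h) = gmult H (\<phi> g) (\<phi> h))"

text \<open>
  A partial isomorphism \<open>vE\<^sup>* \<rightarrow> wE\<^sup>*\<close> is stored as \<open>(v, w, f)\<close>, where \<open>f\<close> is extensional on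
  \<open>vE\<^sup>*\<close>, so that equality of triples is equality of partial isomorphisms.
\<close>

type_synonym ('v, 'e) piso = "'v \<times> 'v \<times> (('v, 'e) fpath \<Rightarrow> ('v, 'e) fpath)"

definition is_piso :: "('v, 'e) pre_digraph \<Rightarrow> ('v, 'e) piso \<Rightarrow> bool" where
  "is_piso E = (\<lambda>(v, w, f).
     v \<in> verts E \<and> w \<in> verts E \<and>
     f \<in> extensional (fpaths E v) \<and>
     bij_betw f (fpaths E v) (fpaths E w) \<and>
     (\<forall>\<mu>\<in>fpaths E v. plen (f \<mu>) = plen \<mu>) \<and>
     (\<forall>\<mu>\<in>fpaths E v. \<forall>e\<in>arcs E. pcat \<mu> (pedge E e) \<in> fpaths E v \<longrightarrow>
        (\<exists>e'\<in>arcs E. head E e' = psource E (f \<mu>) \<and>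
           f (pcat \<mu> (pedge E e)) = pcat (f \<mu>) (pedge E e'))))"

definition PIso :: "('v, 'e) pre_digraph \<Rightarrow> ('v, ('v, 'e) piso) groupoid" where
  "PIso E =
     \<lparr> gunits = verts E,
       garrows = {p. is_piso E p},
       gdom = (\<lambda>(v, w, f). v),
       gcod = (\<lambda>(v, w, f). w),
       gone = (\<lambda>v. (v, v, restrict id (fpaths E v))),
       gmult = (\<lambda>(v, w, f) (v', w', f'). (v', w, compose (fpaths E v') f f')),
       ginv = (\<lambda>(v, w, f). (w, v, restrict (inv_into (fpaths E v) f) (fpaths E w))) \<rparr>"

section \<open>Self-similar groupoid actions\<close>

text \<open>\<open>g \<cdot> \<mu>\<close>, meaningful when \<open>\<mu>\<close> has range \<open>d(g)\<close>.\<close>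

definition act :: "('g \<Rightarrow> ('v, 'e) piso) \<Rightarrow> 'g \<Rightarrow> ('v, 'e) fpath \<Rightarrow> ('v, 'e) fpath" where
  "act \<phi> g \<mu> = snd (snd (\<phi> g)) \<mu>"

definition is_restriction ::
    "('v, 'e) pre_digraph \<Rightarrow> ('v, 'g) groupoid \<Rightarrow> ('g \<Rightarrow> ('v, 'e) piso) \<Rightarrow> 'g \<Rightarrow> 'e \<Rightarrow> 'g \<Rightarrow> bool"
  where
  "is_restriction E G \<phi> g e h \<longleftrightarrow>
     h \<in> garrows G \<and>
     gdom G h = tail E e \<and>
     gcod G h = psource E (act \<phi> g (pedge E e)) \<and>
     (\<forall>\<mu>\<in>fpaths E (tail E e).
        act \<phi> g (pcat (pedge E e) \<mu>) = pcat (act \<phi> g (pedge E e)) (act \<phi> h \<mu>))"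

locale self_similar_action = wf_digraph E + groupoid G
  for E :: "('v, 'e) pre_digraph" and G :: "('v, 'g) groupoid" +
  fixes \<phi> :: "'g \<Rightarrow> ('v, 'e) piso"
  assumes units_eq: "gunits G = verts E"
    and hom: "unital_groupoid_hom G (PIso E) \<phi>"
    and inj: "inj_on \<phi> (garrows G)"
    and restriction_ex:
      "\<lbrakk>g \<in> garrows G; e \<in> arcs E; head E e = gdom G g\<rbrakk> \<Longrightarrow> \<exists>h. is_restriction E G \<phi> g e h"

definition restr_edge ::
    "('v, 'e) pre_digraph \<Rightarrow> ('v, 'g) groupoid \<Rightarrow> ('g \<Rightarrow> ('v, 'e) piso) \<Rightarrow> 'g \<Rightarrow> 'e \<Rightarrow> 'g" where
  "restr_edge E G \<phi> g e = (THE h. is_restriction E G \<phi> g e h)"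

fun restr_edges ::
    "('v, 'e) pre_digraph \<Rightarrow> ('v, 'g) groupoid \<Rightarrow> ('g \<Rightarrow> ('v, 'e) piso) \<Rightarrow> 'g \<Rightarrow> 'e list \<Rightarrow> 'g" where
  "restr_edges E G \<phi> g [] = g"
| "restr_edges E G \<phi> g (e # es) = restr_edges E G \<phi> (restr_edge E G \<phi> g e) es"

text \<open>\<open>g|\<^sub>\<mu>\<close>, meaningful when \<open>\<mu>\<close> has range \<open>d(g)\<close>.\<close>

definition restr ::
    "('v, 'e) pre_digraph \<Rightarrow> ('v, 'g) groupoid \<Rightarrow> ('g \<Rightarrow> ('v, 'e) piso) \<Rightarrow> 'g \<Rightarrow> ('v, 'e) fpath \<Rightarrow> 'g"
  where
  "restr E G \<phi> g \<mu> = restr_edges E G \<phi> g (snd \<mu>)"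

definition contracting ::
    "('v, 'e) pre_digraph \<Rightarrow> ('v, 'g) groupoid \<Rightarrow> ('g \<Rightarrow> ('v, 'e) piso) \<Rightarrow> bool" where
  "contracting E G \<phi> \<longleftrightarrow>
     (\<exists>F. finite F \<and> F \<subseteq> garrows G \<and>
        (\<forall>g\<in>garrows G. \<exists>n. {restr E G \<phi> g \<mu> | \<mu>. \<mu> \<in> fpaths E (gdom G g) \<and> plen \<mu> = n} \<subseteq> F))"

text \<open>The right-infinite path \<open>e\<^sub>1 e\<^sub>2 \<dots>\<close> is the function \<open>y\<close> with \<open>y i = e\<^sub>i\<^sub>+\<^sub>1\<close>.\<close>

definition right_inf :: "('v, 'e) pre_digraph \<Rightarrow> (nat \<Rightarrow> 'e) set" where
  "right_inf E = {y. \<forall>i. y i \<in> arcs E \<and> tail E (y i) = head E (y (Suc i))}"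

definition right_init :: "('v, 'e) pre_digraph \<Rightarrow> (nat \<Rightarrow> 'e) \<Rightarrow> nat \<Rightarrow> ('v, 'e) fpath" where
  "right_init E y n = (head E (y 0), map y [0..<n])"

text \<open>
  \<open>g \<cdot> y\<close> is the path whose initial segment of length \<open>n\<close> is \<open>g\<close> applied to that of \<open>y\<close>, for
  every \<open>n\<close>; its edge number \<open>n\<close> (counting from \<open>0\<close>) is read off from the segment of length
  \<open>n + 1\<close>.
\<close>

definition right_act ::
    "('v, 'e) pre_digraph \<Rightarrow> ('g \<Rightarrow> ('v, 'e) piso) \<Rightarrow> 'g \<Rightarrow> (nat \<Rightarrow> 'e) \<Rightarrow> (nat \<Rightarrow> 'e)" where
  "right_act E \<phi> g y = (\<lambda>n. snd (act \<phi> g (right_init E y (Suc n))) ! n)"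

definition regular ::
    "('v, 'e) pre_digraph \<Rightarrow> ('v, 'g) groupoid \<Rightarrow> ('g \<Rightarrow> ('v, 'e) piso) \<Rightarrow> bool" where
  "regular E G \<phi> \<longleftrightarrow>
     (\<forall>g\<in>garrows G. \<forall>y\<in>right_inf E. head E (y 0) = gdom G g \<and> right_act E \<phi> g y = y \<longrightarrow>
        (\<exists>n. act \<phi> g (right_init E y n) = right_init E y n \<and>
             restr E G \<phi> g (right_init E y n) = gone G (psource E (right_init E y n))))"

section \<open>The limit space\<close>

text \<open>The left-infinite path \<open>\<dots> e\<^sub>-\<^sub>2 e\<^sub>-\<^sub>1\<close> is the function \<open>x\<close> with \<open>x i = e\<^sub>-\<^sub>(\<^sub>i\<^sub>+\<^sub>1\<^sub>)\<close>.\<close>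

definition left_inf :: "('v, 'e) pre_digraph \<Rightarrow> (nat \<Rightarrow> 'e) set" where
  "left_inf E = {x. \<forall>i. x i \<in> arcs E \<and> tail E (x (Suc i)) = head E (x i)}"

definition left_cylinder :: "('v, 'e) pre_digraph \<Rightarrow> (nat \<Rightarrow> 'e) \<Rightarrow> nat \<Rightarrow> (nat \<Rightarrow> 'e) set" where
  "left_cylinder E x n = {y \<in> left_inf E. \<forall>i<n. y i = x i}"

definition left_topology :: "('v, 'e) pre_digraph \<Rightarrow> (nat \<Rightarrow> 'e) topology" where
  "left_topology E = topology_generated_by {left_cylinder E x n | x n. x \<in> left_inf E}"

definition shift :: "(nat \<Rightarrow> 'e) \<Rightarrow> (nat \<Rightarrow> 'e)" where
  "shift x = (\<lambda>i. x (Suc i))"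

text \<open>The finite path \<open>e\<^sub>-\<^sub>(\<^sub>n\<^sub>+\<^sub>1\<^sub>) \<dots> e\<^sub>-\<^sub>1\<close>, which has length \<open>n + 1\<close>.\<close>

definition left_final :: "('v, 'e) pre_digraph \<Rightarrow> (nat \<Rightarrow> 'e) \<Rightarrow> nat \<Rightarrow> ('v, 'e) fpath" where
  "left_final E x n = (head E (x n), rev (map x [0..<Suc n]))"

definition ae_rel ::
    "('v, 'e) pre_digraph \<Rightarrow> ('v, 'g) groupoid \<Rightarrow> ('g \<Rightarrow> ('v, 'e) piso) \<Rightarrow> ((nat \<Rightarrow> 'e) \<times> (nat \<Rightarrow> 'e)) set"
  where
  "ae_rel E G \<phi> = {(x, y). x \<in> left_inf E \<and> y \<in> left_inf E \<and>
     (\<exists>g :: nat \<Rightarrow> 'g. finite (range g) \<and>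
        (\<forall>n. g n \<in> garrows G \<and> gdom G (g n) = head E (x n) \<and>
             act \<phi> (g n) (left_final E x n) = left_final E y n))}"

definition ae_class ::
    "('v, 'e) pre_digraph \<Rightarrow> ('v, 'g) groupoid \<Rightarrow> ('g \<Rightarrow> ('v, 'e) piso) \<Rightarrow> (nat \<Rightarrow> 'e) \<Rightarrow> (nat \<Rightarrow> 'e) set"
  where
  "ae_class E G \<phi> x = ae_rel E G \<phi> `` {x}"

definition limit_space ::
    "('v, 'e) pre_digraph \<Rightarrow> ('v, 'g) groupoid \<Rightarrow> ('g \<Rightarrow> ('v, 'e) piso) \<Rightarrow> (nat \<Rightarrow> 'e) set set" where
  "limit_space E G \<phi> = left_inf E // ae_rel E G \<phi>"

definition limit_topology ::
    "('v, 'e) pre_digraph \<Rightarrow> ('v, 'g) groupoid \<Rightarrow> ('g \<Rightarrow> ('v, 'e) piso) \<Rightarrow> (nat \<Rightarrow> 'e) set topology" where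
  "limit_topology E G \<phi> = topology (\<lambda>U. U \<subseteq> limit_space E G \<phi> \<and>
     openin (left_topology E) {x \<in> left_inf E. ae_class E G \<phi> x \<in> U})"

section \<open>Expanding maps and local homeomorphisms\<close>

definition locally_expanding :: "'a set \<Rightarrow> ('a \<Rightarrow> 'a \<Rightarrow> real) \<Rightarrow> ('a \<Rightarrow> 'a) \<Rightarrow> bool" where
  "locally_expanding M d f \<longleftrightarrow>
     (\<exists>\<delta>>0. \<exists>c>1. \<forall>p\<in>M. \<forall>q\<in>M. d p q < \<delta> \<longrightarrow> d (f p) (f q) \<ge> c * d p q)"

definition local_homeomorphism :: "'a topology \<Rightarrow> 'b topology \<Rightarrow> ('a \<Rightarrow> 'b) \<Rightarrow> bool" where
  "local_homeomorphism X Y f \<longleftrightarrow>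
     (\<forall>p\<in>topspace X. \<exists>U. p \<in> U \<and> openin X U \<and> openin Y (f ` U) \<and>
        homeomorphic_map (subtopology X U) (subtopology Y (f ` U)) f)"

section \<open>Basic consistency facts\<close>

lemma is_fpath_snoc:
  assumes "wf_digraph E"
  shows "is_fpath E v (es @ [e]) \<longleftrightarrow>
    is_fpath E v es \<and> e \<in> arcs E \<and> head E e = psource E (v, es)"
proof (induction es arbitrary: v)
  case Nil
  then show ?case
    using assms by (auto simp: psource_def wf_digraph.head_in_verts wf_digraph.tail_in_verts)
next
  case (Cons a es)
  then show ?case by (auto simp: psource_def)
qed

lemma pcat_pedge_in_fpaths:
  assumes "wf_digraph E"
  shows "pcat \<mu> (pedge E e) \<in> fpaths E v \<longleftrightarrow>
    \<mu> \<in> fpaths E v \<and> e \<in> arcs E \<and> head E e = psource E \<mu>"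
  using is_fpath_snoc[OF assms] by (cases \<mu>) (auto simp: fpaths_def pcat_def pedge_def)

lemma is_piso_id: "v \<in> verts E \<Longrightarrow> wf_digraph E \<Longrightarrow> is_piso E (v, v, restrict id (fpaths E v))"
  by (auto simp: is_piso_def bij_betw_def inj_on_def pcat_pedge_in_fpaths)

lemma is_piso_compose:
  assumes "wf_digraph E" "is_piso E (v, w, f)" "is_piso E (u, v, h)"
  shows "is_piso E (u, w, compose (fpaths E u) f h)"
proof -
  have h: "h \<mu> \<in> fpaths E v" if "\<mu> \<in> fpaths E u" for \<mu>
    using assms(3) that by (auto simp: is_piso_def bij_betw_def)
  have "bij_betw (compose (fpaths E u) f h) (fpaths E u) (fpaths E w)"
    using assms(2,3) bij_betw_compose by (fastforce simp: is_piso_def)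
  moreover have "\<exists>e'\<in>arcs E. head E e' = psource E (f (h \<mu>)) \<and>
      f (h (pcat \<mu> (pedge E e))) = pcat (f (h \<mu>)) (pedge E e')"
    if \<mu>: "\<mu> \<in> fpaths E u" and e: "e \<in> arcs E" "pcat \<mu> (pedge E e) \<in> fpaths E u" for \<mu> e
  proof -
    obtain a where a: "a \<in> arcs E" "h (pcat \<mu> (pedge E e)) = pcat (h \<mu>) (pedge E a)"
      using assms(3) \<mu> e unfolding is_piso_def by blast
    with h[OF e(2)] have "pcat (h \<mu>) (pedge E a) \<in> fpaths E v" by simp
    with a h[OF \<mu>] assms(2) show ?thesis unfolding is_piso_def by auto
  qed
  ultimately show ?thesis
    using assms(2,3) h by (auto simp: is_piso_def compose_def)
qed

lemma is_piso_inverse: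
  assumes wf: "wf_digraph E" and f: "is_piso E (v, w, f)"
  shows "is_piso E (w, v, restrict (inv_into (fpaths E v) f) (fpaths E w))"
proof -
  let ?i = "inv_into (fpaths E v) f"
  have bij: "bij_betw f (fpaths E v) (fpaths E w)" using f by (simp add: is_piso_def)
  have len: "plen (f \<mu>) = plen \<mu>" if "\<mu> \<in> fpaths E v" for \<mu>
    using f that by (simp add: is_piso_def)
  have i: "?i \<nu> \<in> fpaths E v" "f (?i \<nu>) = \<nu>" if "\<nu> \<in> fpaths E w" for \<nu>
    using bij that by (auto simp: bij_betw_def inv_into_into f_inv_into_f)
  have leni: "plen (?i \<nu>) = plen \<nu>" if "\<nu> \<in> fpaths E w" for \<nu>
    using len[OF i(1)[OF that]] i(2)[OF that] by simp
  have "\<exists>e'\<in>arcs E. head E e' = psource E (?i \<nu>) \<and>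
      ?i (pcat \<nu> (pedge E e)) = pcat (?i \<nu>) (pedge E e')"
    if \<nu>: "\<nu> \<in> fpaths E w" and e: "e \<in> arcs E" "pcat \<nu> (pedge E e) \<in> fpaths E w" for \<nu> e
  proof -
    let ?m = "?i (pcat \<nu> (pedge E e))"
    have m: "?m \<in> fpaths E v" "f ?m = pcat \<nu> (pedge E e)" "plen ?m = Suc (plen \<nu>)"
      using i[OF e(2)] leni[OF e(2)] by (auto simp: plen_def pcat_def pedge_def)
    then have "snd ?m \<noteq> []" by (auto simp: plen_def)
    then have "?m = pcat (fst ?m, butlast (snd ?m)) (pedge E (last (snd ?m)))"
      by (simp add: pcat_def pedge_def)
    then obtain \<mu> a where \<mu>: "?m = pcat \<mu> (pedge E a)" by blast
    have \<mu>': "\<mu> \<in> fpaths E v" "a \<in> arcs E" "head E a = psource E \<mu>"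
      using m(1) unfolding \<mu> pcat_pedge_in_fpaths[OF wf] by auto
    obtain b where "f ?m = pcat (f \<mu>) (pedge E b)"
      using f \<mu>' m(1) unfolding \<mu> is_piso_def by blast
    with m(2) have "f \<mu> = \<nu>" by (simp add: pcat_def pedge_def prod_eq_iff)
    then have "?i \<nu> = \<mu>" using \<mu>'(1) bij by (auto simp: bij_betw_def)
    with \<mu> \<mu>' show ?thesis by auto
  qed
  moreover have "bij_betw (restrict ?i (fpaths E w)) (fpaths E w) (fpaths E v)"
    using bij_betw_inv_into[OF bij] by (simp cong: bij_betw_cong)
  ultimately show ?thesis
    using f leni by (auto simp: is_piso_def pcat_pedge_in_fpaths[OF wf])
qed

lemma groupoid_PIso:
  assumes wf: "wf_digraph E"
  shows "groupoid (PIso E)"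
proof -
  have verts: "v \<in> verts E" "w \<in> verts E" if "is_piso E (v, w, f)" for v w f
    using that by (auto simp: is_piso_def)
  have mem: "f \<mu> \<in> fpaths E w" if "is_piso E (v, w, f)" "\<mu> \<in> fpaths E v" for v w f \<mu>
    using that by (auto simp: is_piso_def bij_betw_def)
  have ident: "compose (fpaths E v) f (restrict id (fpaths E v)) = f"
    "compose (fpaths E v) (restrict id (fpaths E w)) f = f" if "is_piso E (v, w, f)" for v w f
  proof -
    have f: "f \<in> fpaths E v \<rightarrow> fpaths E w" "f \<in> extensional (fpaths E v)"
      using that by (auto simp: is_piso_def bij_betw_def)
    show "compose (fpaths E v) f (restrict id (fpaths E v)) = f"
      using compose_Id[OF f] by (simp add: id_def)
    show "compose (fpaths E v) (restrict id (fpaths E w)) f = f"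
      using Id_compose[OF f] by (simp add: id_def)
  qed
  have inv: "\<mu> \<in> fpaths E v \<Longrightarrow> inv_into (fpaths E v) f (f \<mu>) = \<mu>"
    "\<nu> \<in> fpaths E w \<Longrightarrow> f (inv_into (fpaths E v) f \<nu>) = \<nu>"
    "\<nu> \<in> fpaths E w \<Longrightarrow> inv_into (fpaths E v) f \<nu> \<in> fpaths E v"
    if "is_piso E (v, w, f)" for v w f \<mu> \<nu>
    using that by (auto simp: is_piso_def bij_betw_def f_inv_into_f inv_into_into)
  show ?thesis
  proof (unfold_locales, goal_cases)
    case (9 g h k)
    then show ?case
      by (cases g; cases h; cases k) (auto simp: PIso_def compose_def fun_eq_iff dest: mem)
  next
    case (10 g)
    then show ?case
      by (cases g) (simp add: PIso_def ident)
  next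
    case (11 g)
    then show ?case
      by (cases g) (simp add: PIso_def ident)
  next
    case (15 g)
    then show ?case
      by (cases g) (auto simp: PIso_def compose_def fun_eq_iff mem inv)
  next
    case (16 g)
    then show ?case
      by (cases g) (auto simp: PIso_def compose_def fun_eq_iff inv)
  next
    case (6 g h)
    then show ?case
      using wf by (cases g; cases h) (auto simp: PIso_def intro: is_piso_compose)
  next
    case (12 g)
    then show ?case
      using wf by (cases g) (auto simp: PIso_def intro: is_piso_inverse)
  qed (use wf in \<open>auto simp: PIso_def is_piso_id verts\<close>)
qed

lemma (in self_similar_action) restriction_unique:
  assumes "is_restriction E G \<phi> g e h" "is_restriction E G \<phi> g e k"
  shows "h = k"
proof -
  have eq: "snd (snd (\<phi> h)) \<mu> = snd (snd (\<phi> k)) \<mu>" if \<mu>: "\<mu> \<in> fpaths E (tail E e)" for \<mu>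
  proof -
    have h: "\<phi> x \<in> garrows (PIso E)" "gdom (PIso E) (\<phi> x) = tail E e"
      "gcod (PIso E) (\<phi> x) = psource E (act \<phi> g (pedge E e))" if "x \<in> {h, k}" for x
      using assms hom that by (auto simp: is_restriction_def unital_groupoid_hom_def)
    have "fst (act \<phi> x \<mu>) = psource E (act \<phi> g (pedge E e))" if "x \<in> {h, k}" for x
    proof -
      have "act \<phi> x \<mu> \<in> fpaths E (gcod (PIso E) (\<phi> x))"
        using h(1,2)[OF that] \<mu>
        by (cases "\<phi> x") (auto simp: act_def PIso_def is_piso_def bij_betw_def)
      then show ?thesis
        unfolding h(3)[OF that] by (auto simp: fpaths_def)
    qed
    moreover have "snd (act \<phi> h \<mu>) = snd (act \<phi> k \<mu>)"
      using assms \<mu> by (auto simp: is_restriction_def pcat_def)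
    ultimately show ?thesis by (simp add: act_def prod_eq_iff)
  qed
  have "\<phi> h \<in> garrows (PIso E)" "\<phi> k \<in> garrows (PIso E)"
    "gdom (PIso E) (\<phi> h) = tail E e" "gdom (PIso E) (\<phi> k) = tail E e"
    "gcod (PIso E) (\<phi> h) = gcod (PIso E) (\<phi> k)"
    using assms hom by (auto simp: is_restriction_def unital_groupoid_hom_def)
  then have "\<phi> h = \<phi> k"
    using eq by (cases "\<phi> h"; cases "\<phi> k") (auto simp: PIso_def is_piso_def intro!: extensionalityI)
  then show ?thesis using inj assms by (auto simp: is_restriction_def inj_on_def)
qed

lemma topspace_left_topology: "topspace (left_topology E) = left_inf E"
  by (auto simp: left_topology_def topology_generated_by_topspace left_cylinder_def)

lemma openin_limit_topology:
  "openin (limit_topology E G \<phi>) U \<longleftrightarrow>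
     U \<subseteq> limit_space E G \<phi> \<and> openin (left_topology E) {x \<in> left_inf E. ae_class E G \<phi> x \<in> U}"
proof -
  let ?P = "\<lambda>U. {x \<in> left_inf E. ae_class E G \<phi> x \<in> U}"
  have "?P (S \<inter> T) = ?P S \<inter> ?P T" for S T by auto
  moreover have "?P (\<Union>K) = (\<Union>S\<in>K. ?P S)" for K by auto
  ultimately have "istopology (\<lambda>U. U \<subseteq> limit_space E G \<phi> \<and> openin (left_topology E) (?P U))"
    unfolding istopology_def by (auto intro!: openin_Union)
  then show ?thesis
    by (simp add: limit_topology_def)
qed

lemma quotient_map_limit_topology:
  "quotient_map (left_topology E) (limit_topology E G \<phi>) (ae_class E G \<phi>)"
proof -
  have img: "ae_class E G \<phi> ` left_inf E = limit_space E G \<phi>"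
    by (auto simp: limit_space_def ae_class_def quotient_def)
  then have "{x \<in> left_inf E. ae_class E G \<phi> x \<in> limit_space E G \<phi>} = left_inf E" by auto
  then have "openin (limit_topology E G \<phi>) (limit_space E G \<phi>)"
    using openin_topspace[of "left_topology E"]
    by (simp add: openin_limit_topology topspace_left_topology)
  then have "topspace (limit_topology E G \<phi>) = limit_space E G \<phi>"
    by (meson openin_limit_topology openin_subset openin_topspace subset_antisym)
  with img show ?thesis
    by (simp add: quotient_map_def topspace_left_topology openin_limit_topology)
qed

end

theory Submission
  imports Defs
begin

text \<open>
  By contraction there is a finite set \<open>N\<close> of arrows, closed under restriction and inverses, into
  which every finite set of arrows is carried by restriction to sufficiently long paths. Call two
  classes \<open>n\<close>-near if they have representatives whose final segments of length \<open>n + 1\<close> are related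
  by an element of \<open>N\<close>. Since products of three elements of \<open>N\<close> restrict into \<open>N\<close> after boundedly
  many steps, \<open>(n + m)\<close>-nearness composes to \<open>n\<close>-nearness for a constant \<open>m\<close>, so these relations
  are a uniform structure with geometric scales and Frink's chain construction gives a metric. The
  shift lowers nearness by exactly one level: nearness of images lifts because arrows can be
  extended by one more edge, and the lift is locally unique by regularity. A weighted supremum of
  the metric along orbits makes the scaling exact. The metric topology is the quotient topology
  because \<open>E\<^sup>-\<^sup>\<infinity>\<close> is compact and metric spaces are Hausdorff.
\<close>

section \<open>Metrics from expanding entourages\<close>

text \<open>Strong induction on the number of links. Cutting out the link at which the running sum
  passes half of the total leaves two pieces of weight at most half. By induction each piece bridges
  a distance of at most the total, and so does the removed link, so \<open>quasi\<close> reproduces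
  the factor 2.\<close>

lemma chain_sum_ge:
  fixes \<rho> :: "'a \<Rightarrow> 'a \<Rightarrow> real"
  assumes nonneg: "\<And>p q. 0 \<le> \<rho> p q"
    and self: "\<And>p. p \<in> M \<Longrightarrow> \<rho> p p = 0"
    and quasi: "\<And>p q r s. \<lbrakk>p \<in> M; q \<in> M; r \<in> M; s \<in> M\<rbrakk>
      \<Longrightarrow> \<rho> p s \<le> 2 * max (\<rho> p q) (max (\<rho> q r) (\<rho> r s))"
    and x: "\<And>k. x k \<in> M"
  shows "\<rho> (x i) (x (i + n)) \<le> 2 * (\<Sum>k\<in>{i..<i + n}. \<rho> (x k) (x (Suc k)))"
proof (induction n arbitrary: i rule: less_induct)
  case (less n)
  show ?case
  proof (cases "n = 0")
    case True
    then show ?thesis using self x by simp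
  next
    case False
    define S where "S a b = (\<Sum>k\<in>{a..<b}. \<rho> (x k) (x (Suc k)))" for a b
    define a where "a = S i (i + n)"
    have split: "S u w = S u v + S v w" if "u \<le> v" "v \<le> w" for u v w
      unfolding S_def using that by (simp add: sum.atLeastLessThan_concat)
    have S0: "0 \<le> S u v" for u v
      unfolding S_def by (intro sum_nonneg nonneg)
    let ?P = "\<lambda>j. j < n \<and> S i (i + j) \<le> a / 2"
    have P0: "?P 0" using False S0[of i "i + n"] by (simp add: S_def a_def)
    \<comment> \<open>The last cut whose prefix weighs at most half. \<open>j < n\<close> keeps link
      \<open>j\<close> inside the chain; by maximality the prefix including that link weighs at
      least half, so the suffix behind it weighs at most half.\<close>
    define j where "j = (GREATEST j. ?P j)"
    have j: "?P j" unfolding j_def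
      by (rule GreatestI_nat[of ?P 0 n]) (use P0 in auto)
    have jmax: "k \<le> j" if "?P k" for k
      unfolding j_def by (rule Greatest_le_nat[of ?P k n]) (use that in auto)
    have "a / 2 \<le> S i (i + Suc j)"
    proof (cases "Suc j < n")
      case True
      then show ?thesis using jmax[of "Suc j"] by linarith
    next
      case False
      with j have "Suc j = n" by simp
      then show ?thesis using S0[of i "i + n"] by (simp add: a_def)
    qed
    then have suf: "S (i + Suc j) (i + n) \<le> a / 2"
      using split[of i "i + Suc j" "i + n"] j by (simp add: a_def)
    have mid: "\<rho> (x (i + j)) (x (i + Suc j)) \<le> a"
      using split[of i "i + j" "i + n"] split[of "i + j" "i + Suc j" "i + n"] j
        S0[of i "i + j"] S0[of "i + Suc j" "i + n"]
      by (simp add: a_def) (simp add: S_def)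
    have 1: "\<rho> (x i) (x (i + j)) \<le> a"
      using less[of j i] j by (simp add: S_def)
    have "\<rho> (x (i + Suc j)) (x (i + Suc j + (n - Suc j))) \<le> 2 * S (i + Suc j) (i + Suc j + (n - Suc j))"
      using less[of "n - Suc j" "i + Suc j"] False by (simp add: S_def)
    then have 2: "\<rho> (x (i + Suc j)) (x (i + n)) \<le> a"
      using suf j by simp
    have "\<rho> (x i) (x (i + n)) \<le> 2 * a"
      using quasi[OF x x x x, of i "i + n" "i + j" "i + Suc j"] mid 1 2 by linarith
    then show ?thesis by (simp add: a_def S_def)
  qed
qed

text \<open>\<open>d\<close> is the infimum of the weights of chains from \<open>p\<close> to
  \<open>q\<close>. The triangle inequality holds because chains concatenate, and
  \<open>chain_sum_ge\<close> keeps \<open>d\<close> from dropping below half of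
  \<open>\<rho>\<close>.\<close>

lemma frink_metrization:
  fixes \<rho> :: "'a \<Rightarrow> 'a \<Rightarrow> real"
  assumes nonneg: "\<And>p q. 0 \<le> \<rho> p q"
    and zero: "\<And>p q. \<lbrakk>p \<in> M; q \<in> M\<rbrakk> \<Longrightarrow> \<rho> p q = 0 \<longleftrightarrow> p = q"
    and commute: "\<And>p q. \<lbrakk>p \<in> M; q \<in> M\<rbrakk> \<Longrightarrow> \<rho> p q = \<rho> q p"
    and quasi: "\<And>p q r s. \<lbrakk>p \<in> M; q \<in> M; r \<in> M; s \<in> M\<rbrakk>
      \<Longrightarrow> \<rho> p s \<le> 2 * max (\<rho> p q) (max (\<rho> q r) (\<rho> r s))"
  obtains d where "Metric_space M d"
    and "\<And>p q. \<lbrakk>p \<in> M; q \<in> M\<rbrakk> \<Longrightarrow> d p q \<le> \<rho> p q"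
    and "\<And>p q. \<lbrakk>p \<in> M; q \<in> M\<rbrakk> \<Longrightarrow> \<rho> p q \<le> 2 * d p q"
proof -
  define S where "S x n = (\<Sum>k<n. \<rho> (x k) (x (Suc k)))" for x :: "nat \<Rightarrow> 'a" and n
  \<comment> \<open>A chain is a full sequence in \<open>M\<close> of which only the entries up to
    \<open>n\<close> count, so reversed and concatenated chains are given by plain formulas.\<close>
  define C where "C p q = {S x n | x n. (\<forall>k. x k \<in> M) \<and> x 0 = p \<and> x n = q}" for p q
  \<comment> \<open>\<open>Metric_space\<close> demands nonnegativity and symmetry for all
    arguments, hence a default value outside \<open>M\<close>.\<close>
  define d where "d p q = (if p \<in> M \<and> q \<in> M then Inf (C p q) else 0)" for p q
  have S0: "0 \<le> S x n" for x n
    unfolding S_def by (intro sum_nonneg nonneg)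
  have bdd: "bdd_below (C p q)" for p q
    by (rule bdd_belowI[of _ 0]) (auto simp: C_def S0)
  have \<rho>C: "\<rho> p q \<in> C p q" if "p \<in> M" "q \<in> M" for p q
    using that unfolding C_def
    by (intro CollectI exI[of _ "\<lambda>k. if k = 0 then p else q"] exI[of _ 1]) (auto simp: S_def)
  have lower: "\<rho> p q \<le> 2 * a" if "a \<in> C p q" for p q a
    using that chain_sum_ge[of \<rho> M _ 0, OF nonneg _ quasi] zero
    by (fastforce simp: C_def S_def atLeast0LessThan)
  have d_lower: "\<rho> p q \<le> 2 * d p q" if "p \<in> M" "q \<in> M" for p q
  proof -
    have "\<rho> p q / 2 \<le> Inf (C p q)"
      using \<rho>C[OF that] lower by (intro cInf_greatest) (auto simp: field_simps)
    then show ?thesis using that by (simp add: d_def)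
  qed
  have d_upper: "d p q \<le> \<rho> p q" if "p \<in> M" "q \<in> M" for p q
    using that cInf_lower[OF \<rho>C bdd] by (simp add: d_def)
  have C_commute: "C p q \<subseteq> C q p" for p q
  proof
    fix a assume "a \<in> C p q"
    then obtain x n where x: "\<forall>k. x k \<in> M" "x 0 = p" "x n = q" "a = S x n"
      by (auto simp: C_def)
    have "S x n = (\<Sum>k<n. \<rho> (x (n - Suc k)) (x (Suc (n - Suc k))))"
      unfolding S_def by (rule sum.nat_diff_reindex[symmetric])
    also have "\<dots> = S (\<lambda>k. x (n - k)) n"
      unfolding S_def using x commute by (intro sum.cong) (auto simp: Suc_diff_Suc)
    finally show "a \<in> C q p"
      unfolding C_def using x by (intro CollectI exI[of _ "\<lambda>k. x (n - k)"] exI[of _ n]) auto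
  qed
  have C_add: "a + b \<in> C p r" if ab: "a \<in> C p q" "b \<in> C q r" for p q r a b
  proof -
    obtain x n where x: "\<forall>k. x k \<in> M" "x 0 = p" "x n = q" "a = S x n"
      using ab(1) by (auto simp: C_def)
    obtain y l where y: "\<forall>k. y k \<in> M" "y 0 = q" "y l = r" "b = S y l"
      using ab(2) by (auto simp: C_def)
    define z where "z k = (if k \<le> n then x k else y (k - n))" for k
    have "S z (n + l) = S z n + (\<Sum>k<l. \<rho> (z (n + k)) (z (Suc (n + k))))"
      unfolding S_def by (induction l) auto
    also have "S z n = a" unfolding S_def x z_def by (intro sum.cong) auto
    also have "(\<Sum>k<l. \<rho> (z (n + k)) (z (Suc (n + k)))) = b"
      unfolding S_def x y z_def using x y by (intro sum.cong) (auto simp: Suc_diff_le)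
    finally have "a + b = S z (n + l)" by simp
    moreover have "(\<forall>k. z k \<in> M) \<and> z 0 = p \<and> z (n + l) = r"
      using x y by (auto simp: z_def)
    ultimately show ?thesis unfolding C_def by blast
  qed
  have "Metric_space M d"
  proof
    show "0 \<le> d p q" for p q
      using d_lower[of p q] nonneg[of p q] by (cases "p \<in> M \<and> q \<in> M") (auto simp: d_def)
    show "d p q = d q p" for p q
      using C_commute by (auto simp: d_def intro!: arg_cong[of _ _ Inf])
    show "(d p q = 0) = (p = q)" if "p \<in> M" "q \<in> M" for p q
      using d_lower[OF that] d_upper[OF that] zero[OF that] nonneg[of p q] by auto
    show "d p r \<le> d p q + d q r" if "p \<in> M" "q \<in> M" "r \<in> M" for p q r
    proof -
      have "Inf (C p r) \<le> a + b" if "a \<in> C p q" "b \<in> C q r" for a b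
        using C_add[OF that] bdd by (intro cInf_lower)
      then have "Inf (C p r) - b \<le> Inf (C p q)" if "b \<in> C q r" for b
        using \<rho>C[of p q] \<open>p \<in> M\<close> \<open>q \<in> M\<close> that by (intro cInf_greatest) (auto simp: field_simps)
      then have "Inf (C p r) - Inf (C p q) \<le> Inf (C q r)"
        using \<rho>C[of q r] that by (intro cInf_greatest) (auto simp: algebra_simps)
      then show ?thesis using that by (simp add: d_def)
    qed
  qed
  then show ?thesis using that d_lower d_upper by blast
qed

section \<open>Expanding scales and exactly scaled metrics\<close>

text \<open>\<open>V n\<close> plays the role of the entourage \<open>d p q < c\<^sup>-\<^sup>n\<close> of the metric to be constructed.\<close>

locale expanding_scale =
  fixes M :: "'a set" and V :: "nat \<Rightarrow> 'a \<Rightarrow> 'a \<Rightarrow> bool" and f :: "'a \<Rightarrow> 'a" and m K :: nat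
  assumes closed: "p \<in> M \<Longrightarrow> f p \<in> M"
    and refl: "p \<in> M \<Longrightarrow> V n p p"
    and sym: "\<lbrakk>p \<in> M; q \<in> M; V n p q\<rbrakk> \<Longrightarrow> V n q p"
    and Suc_imp: "\<lbrakk>p \<in> M; q \<in> M; V (Suc n) p q\<rbrakk> \<Longrightarrow> V n p q"
    and comp: "\<lbrakk>p \<in> M; q \<in> M; r \<in> M; V (n + m) p q; V (n + m) q r\<rbrakk> \<Longrightarrow> V n p r"
    and separated: "\<lbrakk>p \<in> M; q \<in> M; \<And>n. V n p q\<rbrakk> \<Longrightarrow> p = q"
    and image: "\<lbrakk>p \<in> M; q \<in> M; V (Suc n) p q\<rbrakk> \<Longrightarrow> V n (f p) (f q)"
    and lift: "\<lbrakk>p \<in> M; q \<in> M; V n (f p) q\<rbrakk> \<Longrightarrow> \<exists>q'\<in>M. f q' = q \<and> V (Suc n) p q'"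
    and locally_inj: "\<lbrakk>p \<in> M; q \<in> M; V K p q; f p = f q\<rbrakk> \<Longrightarrow> p = q"
begin

lemma antimono: "\<lbrakk>p \<in> M; q \<in> M; V n p q; k \<le> n\<rbrakk> \<Longrightarrow> V k p q"
  by (induction n) (use Suc_imp le_Suc_eq in blast)+

lemma funpow_closed: "p \<in> M \<Longrightarrow> (f ^^ k) p \<in> M"
  by (induction k) (auto simp: closed)

lemma image_funpow: "\<lbrakk>p \<in> M; q \<in> M; V (n + k) p q\<rbrakk> \<Longrightarrow> V n ((f ^^ k) p) ((f ^^ k) q)"
proof (induction k arbitrary: n)
  case (Suc k)
  then have "V (Suc n + k) p q" by simp
  then have "V (Suc n) ((f ^^ k) p) ((f ^^ k) q)"
    using Suc by blast
  then show ?case using image funpow_closed Suc by auto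
qed simp

text \<open>\<open>lift\<close> yields some preimage \<open>q'\<close> of \<open>f q\<close> at the
  right level from \<open>p\<close>. Above level \<open>K + m\<close> both \<open>q\<close> and
  \<open>q'\<close> are so close to \<open>p\<close> that \<open>comp\<close> puts them at level
  \<open>K\<close>, and local injectivity identifies them.\<close>

lemma image_iff:
  assumes "p \<in> M" "q \<in> M" "V (K + m) p q"
  shows "V n (f p) (f q) \<longleftrightarrow> V (Suc n) p q"
proof
  assume n: "V n (f p) (f q)"
  obtain q' where q': "q' \<in> M" "f q' = f q" "V (Suc n) p q'"
    using lift[OF assms(1) closed[OF assms(2)] n] by blast
  show "V (Suc n) p q"
  proof (cases "Suc n \<le> K + m")
    case True
    then show ?thesis using antimono assms by blast
  next
    case False
    then have "V (K + m) p q'" using antimono[OF assms(1) q'(1,3)] by simp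
    then have "V K q q'" using comp[of q p q' K] sym assms q' by blast
    then show ?thesis using locally_inj q' assms by metis
  qed
qed (use image assms in blast)

text \<open>The factor \<open>2\<close> lost in the chain construction is regained by passing to an iterate of
  \<open>f\<close>; the supremum over the orbit then turns expansion by an iterate into exact scaling by \<open>f\<close>.\<close>

theorem self_similar_metric:
  obtains \<epsilon> c :: real and D where "0 < \<epsilon>" "1 < c" "Metric_space M D"
    and "\<And>p q. \<lbrakk>p \<in> M; q \<in> M; D p q < \<epsilon>\<rbrakk> \<Longrightarrow> D (f p) (f q) = c * D p q"
    and "\<And>p \<alpha>. \<lbrakk>p \<in> M; \<alpha> \<le> \<epsilon>\<rbrakk>
      \<Longrightarrow> f ` Metric_space.mball M D p \<alpha> = Metric_space.mball M D (f p) (c * \<alpha>)"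
    and "\<And>\<delta>. 0 < \<delta> \<Longrightarrow> \<exists>n. \<forall>p\<in>M. \<forall>q\<in>M. V n p q \<longrightarrow> D p q < \<delta>"
proof -
  \<comment> \<open>Composing three relations costs at most \<open>2 * m\<close> levels, and
    \<open>b\<close> makes \<open>T\<close> levels worth a factor of one half. The successor keeps
    the index of the root positive.\<close>
  define T where "T = Suc (2 * m)"
  define b :: real where "b = root T (1/2)"
  have b: "0 < b" "b < 1" "b ^ T = 1/2"
    using real_root_pow_pos2[of T "1/2"] by (auto simp: b_def T_def simp del: power_Suc)
  \<comment> \<open>The first level that fails, so that \<open>V n p q\<close> becomes
    \<open>\<rho> p q < b ^ n\<close>. For equal points no level fails, so \<open>\<rho>\<close>
    treats them separately.\<close>
  define lev where "lev p q = (LEAST n. \<not> V n p q)" for p q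
  define \<rho> where "\<rho> p q = (if p = q then 0 else b ^ lev p q)" for p q
  have lev: "V n p q \<longleftrightarrow> n < lev p q" if "p \<in> M" "q \<in> M" "p \<noteq> q" for p q n
  proof -
    obtain k where "\<not> V k p q" using separated \<open>p \<in> M\<close> \<open>q \<in> M\<close> \<open>p \<noteq> q\<close> by blast
    then have "\<not> V (lev p q) p q" unfolding lev_def by (rule LeastI)
    then show ?thesis
      using antimono[of p q n "lev p q"] that not_less_Least[of n "\<lambda>n. \<not> V n p q"]
      by (metis lev_def not_le)
  qed
  have V_iff: "V n p q \<longleftrightarrow> \<rho> p q < b ^ n" if "p \<in> M" "q \<in> M" for p q n
    using that lev[OF that] refl b by (auto simp: \<rho>_def power_strict_decreasing_iff)
  have \<rho>0: "0 \<le> \<rho> p q" and \<rho>1: "\<rho> p q \<le> 1" for p q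
    using b by (auto simp: \<rho>_def power_le_one)
  have \<rho>_cases: "\<rho> p q = 0 \<or> (\<exists>n. \<rho> p q = b ^ n)" for p q
    by (auto simp: \<rho>_def)
  have lev_sym: "lev p q = lev q p" if "p \<in> M" "q \<in> M" for p q
    unfolding lev_def using sym that by metis
  obtain d where d: "Metric_space M d" and d_le: "\<And>p q. \<lbrakk>p \<in> M; q \<in> M\<rbrakk> \<Longrightarrow> d p q \<le> \<rho> p q"
    and d_ge: "\<And>p q. \<lbrakk>p \<in> M; q \<in> M\<rbrakk> \<Longrightarrow> \<rho> p q \<le> 2 * d p q"
  proof (rule frink_metrization[of \<rho> M])
    show "0 \<le> \<rho> p q" for p q by (rule \<rho>0)
    show "(\<rho> p q = 0) = (p = q)" for p q using b by (simp add: \<rho>_def)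
    show "\<rho> p q = \<rho> q p" if "p \<in> M" "q \<in> M" for p q using that lev_sym by (simp add: \<rho>_def)
    show "\<rho> p s \<le> 2 * max (\<rho> p q) (max (\<rho> q r) (\<rho> r s))" (is "_ \<le> 2 * ?x")
      if M: "p \<in> M" "q \<in> M" "r \<in> M" "s \<in> M" for p q r s
    proof (rule ccontr)
      \<comment> \<open>Since \<open>b ^ n\<close> is twice \<open>b ^ (n + T)\<close>, a violation
        puts all three links at level \<open>n + T\<close>, hence the pair \<open>p\<close>,
        \<open>s\<close> at level \<open>n\<close>, against
        \<open>\<rho> p s = b ^ n\<close>.\<close>
      assume less: "\<not> \<rho> p s \<le> 2 * ?x"
      then obtain n where n: "\<rho> p s = b ^ n" using \<rho>_cases[of p s] \<rho>0[of p q] by force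
      have "b ^ (n + T) = b ^ n / 2" using b by (simp add: power_add)
      with less n have "\<rho> p q < b ^ (n + T)" "\<rho> q r < b ^ (n + T)" "\<rho> r s < b ^ (n + T)" by auto
      then have "V (n + T) p q" "V (n + T) q r" "V (n + T) r s" using V_iff M by auto
      moreover have "n + m + m \<le> n + T" "n + m \<le> n + T" by (auto simp: T_def)
      ultimately have "V (n + m + m) p q" "V (n + m + m) q r" "V (n + m) r s"
        using antimono M by blast+
      then have "V (n + m) p r" "V (n + m) r s"
        using comp M by blast+
      then have "V n p s" using comp M by blast
      then show False using V_iff M n by simp
    qed
  qed blast
  interpret d: Metric_space M d by fact
  \<comment> \<open>\<open>J\<close> levels change \<open>\<rho>\<close> by the factor 4. A factor 2
    is lost in comparing \<open>d\<close> with \<open>\<rho>\<close>; the other factor 2 is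
    \<open>c ^ J\<close>.\<close>
  define J where "J = 2 * T"
  define c :: real where "c = root J 2"
  have c: "1 < c" "c ^ J = 2"
    using real_root_pow_pos2[of J 2] by (auto simp: c_def J_def T_def simp del: power_Suc)
  define t where "t p q k = d ((f ^^ k) p) ((f ^^ k) q) / c ^ k" for p q k
  define D where "D p q = (if p \<in> M \<and> q \<in> M then SUP k. t p q k else 0)" for p q
  have d1: "d p q \<le> 1" if "p \<in> M" "q \<in> M" for p q
    using d_le[OF that] \<rho>1[of p q] by simp
  have t_le: "t p q k \<le> 1 / c ^ k" if "p \<in> M" "q \<in> M" for p q k
    unfolding t_def using that c by (intro divide_right_mono d1 funpow_closed) auto
  have t_le1: "t p q k \<le> 1" if "p \<in> M" "q \<in> M" for p q k
    using t_le[OF that, of k] c by (smt (verit) divide_le_eq_1 one_le_power)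
  have bdd: "bdd_above (range (t p q))" if "p \<in> M" "q \<in> M" for p q
    using t_le1[OF that] by (intro bdd_aboveI[of _ 1]) auto
  have t_D: "t p q k \<le> D p q" if "p \<in> M" "q \<in> M" for p q k
    using that bdd by (auto simp: D_def intro!: cSUP_upper)
  have D_least: "D p q \<le> a" if "p \<in> M" "q \<in> M" "\<And>k. t p q k \<le> a" for p q a
    using that by (auto simp: D_def intro!: cSUP_least)
  have d_D: "d p q \<le> D p q" if "p \<in> M" "q \<in> M" for p q
    using t_D[OF that, of 0] by (simp add: t_def)
  have D: "Metric_space M D"
  proof
    show "0 \<le> D p q" for p q
      using order_trans[OF d.nonneg d_D] by (cases "p \<in> M \<and> q \<in> M") (auto simp: D_def)
    show "D p q = D q p" for p q
      by (auto simp: D_def t_def d.commute)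
    show "(D p q = 0) = (p = q)" if "p \<in> M" "q \<in> M" for p q
    proof
      assume "D p q = 0"
      then show "p = q"
        using d_D[OF that] d.nonneg[of p q] d.zero[OF that] by auto
    next
      assume "p = q"
      then show "D p q = 0"
        using that funpow_closed d.zero by (simp add: D_def t_def)
    qed
    show "D p r \<le> D p q + D q r" if "p \<in> M" "q \<in> M" "r \<in> M" for p q r
    proof (rule D_least)
      fix k
      have "t p r k \<le> t p q k + t q r k"
        using c d.triangle[of "(f ^^ k) p" "(f ^^ k) q" "(f ^^ k) r"] that
        by (simp add: t_def funpow_closed divide_right_mono flip: add_divide_distrib)
      then show "t p r k \<le> D p q + D q r"
        using t_D[of p q k] t_D[of q r k] that by linarith
    qed (use that in auto)
  qed
  interpret D: Metric_space M D by fact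
  have \<rho>_expand: "\<rho> (f p) (f q) = \<rho> p q / b" if M: "p \<in> M" "q \<in> M" and V: "V (K + m) p q" for p q
  proof (cases "p = q")
    case False
    then have neq: "f p \<noteq> f q"
      using locally_inj[OF M] antimono[OF M V, of K] by auto
    have "n < lev (f p) (f q) \<longleftrightarrow> Suc n < lev p q" for n
      using image_iff[OF M V] lev[OF M False] lev[OF _ _ neq] closed M by auto
    moreover obtain k where k: "lev p q = Suc k"
      using lev[OF M False, of "K + m"] V by (cases "lev p q") auto
    ultimately have "n < lev (f p) (f q) \<longleftrightarrow> n < k" for n by simp
    with k have "lev p q = Suc (lev (f p) (f q))"
      by (metis less_irrefl_nat linorder_neqE_nat)
    then show ?thesis using False neq b by (simp add: \<rho>_def)
  qed (simp add: \<rho>_def)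
  have \<rho>_expand_iter: "\<rho> ((f ^^ k) p) ((f ^^ k) q) = \<rho> p q / b ^ k"
    if M: "p \<in> M" "q \<in> M" and V: "V (K + m + k) p q" for p q k
    using V
  proof (induction k)
    case (Suc k)
    have "V (Suc (K + m + k)) p q" using Suc.prems by simp
    then have "V (K + m + k) p q" using Suc_imp M by blast
    moreover from this have "V (K + m) ((f ^^ k) p) ((f ^^ k) q)"
      using image_funpow M by blast
    ultimately show ?case
      using Suc.IH \<rho>_expand[of "(f ^^ k) p" "(f ^^ k) q"] M by (simp add: funpow_closed)
  qed simp
  \<comment> \<open>\<open>D p q < \<delta>\<close> forces level \<open>K + m + J\<close>, so each
    of the first \<open>J\<close> applications of \<open>f\<close> meets a pair at level
    \<open>K + m\<close>, where \<open>\<rho>_expand\<close> applies.\<close>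
  define \<delta> where "\<delta> = b ^ (K + m + J) / 2"
  have \<delta>: "0 < \<delta>" using b by (simp add: \<delta>_def)
  have D_V: "V n p q" if "p \<in> M" "q \<in> M" "D p q < b ^ n / 2" for p q n
    using d_D[of p q] d_ge[of p q] V_iff[of p q n] that by simp
  have D_upper: "D (f p) (f q) \<le> c * D p q" if M: "p \<in> M" "q \<in> M" for p q
  proof (rule D_least)
    fix k
    \<comment> \<open>Passing to the images drops the term of index 0 and multiplies the others by
      \<open>c\<close>.\<close>
    have "t (f p) (f q) k = c * t p q (Suc k)"
      using c by (simp add: t_def funpow_swap1)
    then show "t (f p) (f q) k \<le> c * D p q"
      using t_D[OF M, of "Suc k"] c by simp
  qed (use M closed in auto)
  \<comment> \<open>For close points the term of index 0 is at most the term of index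
    \<open>J\<close>, so dropping it does not lower the supremum.\<close>
  have D_scale: "D (f p) (f q) = c * D p q" if M: "p \<in> M" "q \<in> M" and less: "D p q < \<delta>" for p q
  proof (rule antisym[OF D_upper[OF M]])
    have V: "V (K + m + J) p q" using D_V[OF M] less by (simp add: \<delta>_def)
    have bJ: "b ^ J = 1/4"
      by (simp add: J_def mult_2 power_add b(3))
    have "\<rho> ((f ^^ J) p) ((f ^^ J) q) = 4 * \<rho> p q"
      using \<rho>_expand_iter[OF M V] by (simp add: bJ)
    then have "d p q \<le> t p q J"
      using d_le[OF M] d_ge[of "(f ^^ J) p" "(f ^^ J) q"] M funpow_closed c by (simp add: t_def)
    moreover have J: "J = Suc (J - 1)" by (simp add: J_def T_def)
    have Suc_t: "t p q (Suc k) \<le> D (f p) (f q) / c" for k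
    proof -
      have "t p q (Suc k) = t (f p) (f q) k / c"
        by (simp add: t_def funpow_swap1)
      then show ?thesis using t_D[of "f p" "f q" k] M closed c by (simp add: divide_right_mono)
    qed
    moreover have "t p q 0 = d p q" by (simp add: t_def)
    ultimately have "t p q 0 \<le> D (f p) (f q) / c"
      using Suc_t[of "J - 1"] J by (metis order_trans)
    with Suc_t have "t p q k \<le> D (f p) (f q) / c" for k by (cases k) auto
    then have "D p q \<le> D (f p) (f q) / c" by (rule D_least[OF M])
    then show "c * D p q \<le> D (f p) (f q)" using c by (simp add: field_simps)
  qed
  \<comment> \<open>Terms beyond \<open>k0\<close> are small for every pair because \<open>d\<close>
    is at most 1; those up to \<open>k0\<close> are controlled by level
    \<open>n + k0\<close>.\<close>
  have V_D: "\<exists>n. \<forall>p\<in>M. \<forall>q\<in>M. V n p q \<longrightarrow> D p q < e" if e: "0 < e" for e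
  proof -
    obtain k0 where k0: "(1 / c) ^ k0 < e / 2"
      using real_arch_pow_inv[of "e / 2" "1 / c"] e c by auto
    obtain n where n: "b ^ n < e / 2"
      using real_arch_pow_inv[of "e / 2" b] e b by auto
    have "D p q < e" if M: "p \<in> M" "q \<in> M" and V: "V (n + k0) p q" for p q
    proof -
      have "t p q k \<le> e / 2" for k
      proof (cases "k \<le> k0")
        case True
        have "V (n + k) p q" using antimono[OF M V] True by simp
        then have "\<rho> ((f ^^ k) p) ((f ^^ k) q) < b ^ n"
          using image_funpow M V_iff funpow_closed by blast
        then have "d ((f ^^ k) p) ((f ^^ k) q) < e / 2"
          using d_le[of "(f ^^ k) p" "(f ^^ k) q"] M funpow_closed n by fastforce
        moreover have "t p q k \<le> d ((f ^^ k) p) ((f ^^ k) q)"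
          using mult_left_mono[OF one_le_power[of c k] d.nonneg[of "(f ^^ k) p" "(f ^^ k) q"]] c
          by (simp add: t_def divide_le_eq)
        ultimately show ?thesis by simp
      next
        case False
        have "t p q k \<le> (1 / c) ^ k" using t_le[OF M] by (simp add: power_one_over)
        also have "\<dots> \<le> (1 / c) ^ k0" using False c by (intro power_decreasing) auto
        finally show ?thesis using k0 by simp
      qed
      then have "D p q \<le> e / 2" by (rule D_least[OF M])
      then show ?thesis using e by simp
    qed
    then show ?thesis by blast
  qed
  obtain n0 where n0: "\<And>p q. \<lbrakk>p \<in> M; q \<in> M; V n0 p q\<rbrakk> \<Longrightarrow> D p q < \<delta>"
    using V_D[OF \<delta>] by blast
  \<comment> \<open>The second bound serves surjectivity onto balls: a point within
    \<open>c * \<epsilon>\<close> of \<open>f p\<close> is at level \<open>n0\<close> from it, so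
    its lift is within \<open>\<delta>\<close> of \<open>p\<close>, where scaling is exact.\<close>
  define \<epsilon> where "\<epsilon> = min \<delta> (b ^ n0 / 2 / c)"
  have \<epsilon>: "0 < \<epsilon>" "\<epsilon> \<le> \<delta>" "c * \<epsilon> \<le> b ^ n0 / 2"
    using \<delta> b c by (auto simp: \<epsilon>_def min_def field_simps)
  have ball: "f ` D.mball p \<alpha> = D.mball (f p) (c * \<alpha>)" if p: "p \<in> M" and \<alpha>: "\<alpha> \<le> \<epsilon>" for p \<alpha>
  proof (intro antisym subsetI)
    fix q assume "q \<in> f ` D.mball p \<alpha>"
    then show "q \<in> D.mball (f p) (c * \<alpha>)"
      using D_scale[of p] \<alpha> \<epsilon> closed c by (auto simp: D.in_mball)
  next
    fix q assume "q \<in> D.mball (f p) (c * \<alpha>)"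
    then have q: "q \<in> M" "D (f p) q < c * \<alpha>" by (auto simp: D.in_mball)
    have "c * \<alpha> \<le> c * \<epsilon>" using \<alpha> c by simp
    then have "V n0 (f p) q" using D_V[of "f p" q n0] q \<epsilon> p closed by simp
    then obtain q' where q': "q' \<in> M" "f q' = q" "V (Suc n0) p q'" using lift p q by blast
    then have "D p q' < \<delta>" using n0 Suc_imp p by blast
    then have "D p q' < \<alpha>" using D_scale[of p q'] p q q' c by simp
    then show "q \<in> f ` D.mball p \<alpha>" using p q' by (force simp: D.in_mball)
  qed
  show ?thesis
  proof (rule that[OF \<epsilon>(1) c(1) D])
    show "D (f p) (f q) = c * D p q" if "p \<in> M" "q \<in> M" "D p q < \<epsilon>" for p q
      using D_scale that \<epsilon> by simp
  qed (use ball V_D in auto)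
qed

end

section \<open>Groupoid arrows acting on edge lists\<close>

abbreviation path_end :: "('v, 'e) pre_digraph \<Rightarrow> 'v \<Rightarrow> 'e list \<Rightarrow> 'v" where
  "path_end E v es \<equiv> psource E (v, es)"

lemma path_end_simps [simp]:
  "path_end E v [] = v" "path_end E v (e # es) = path_end E (tail E e) es"
  by (auto simp: psource_def)

lemma path_end_append [simp]: "path_end E v (es @ fs) = path_end E (path_end E v es) fs"
  by (induction es arbitrary: v) auto

context wf_digraph
begin

lemma is_fpath_verts: "is_fpath G v es \<Longrightarrow> v \<in> verts G"
  by (cases es) auto

lemma is_fpath_append:
  "is_fpath G v (es @ fs) \<longleftrightarrow> is_fpath G v es \<and> is_fpath G (path_end G v es) fs"
  by (induction es arbitrary: v) (auto dest: is_fpath_verts)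

lemma path_end_in_verts: "is_fpath G v es \<Longrightarrow> path_end G v es \<in> verts G"
  by (induction es arbitrary: v) auto

end

lemma is_fpath_set: "is_fpath E v es \<Longrightarrow> set es \<subseteq> arcs E"
  by (induction es arbitrary: v) auto

context self_similar_action
begin

text \<open>All paths on which \<open>g\<close> acts have range \<open>gdom G g\<close>, so the edge
  list carries the remaining information and concatenation becomes \<open>@\<close>.\<close>

definition gact :: "'g \<Rightarrow> 'e list \<Rightarrow> 'e list" where
  "gact g es = snd (act \<phi> g (gdom G g, es))"

abbreviation res1 :: "'g \<Rightarrow> 'e \<Rightarrow> 'g" where
  "res1 \<equiv> restr_edge E G \<phi>"

abbreviation res :: "'g \<Rightarrow> 'e list \<Rightarrow> 'g" where
  "res \<equiv> restr_edges E G \<phi>"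

lemma phi_eq:
  assumes "g \<in> garrows G"
  shows "\<phi> g = (gdom G g, gcod G g, snd (snd (\<phi> g)))" and "is_piso E (\<phi> g)"
    and "fst (\<phi> g) = gdom G g"
proof -
  have "\<phi> g \<in> garrows (PIso E)" "gdom (PIso E) (\<phi> g) = gdom G g" "gcod (PIso E) (\<phi> g) = gcod G g"
    using hom assms by (auto simp: unital_groupoid_hom_def)
  then show "\<phi> g = (gdom G g, gcod G g, snd (snd (\<phi> g)))" "is_piso E (\<phi> g)" "fst (\<phi> g) = gdom G g"
    by (auto simp: PIso_def split: prod.splits)
qed

lemma piso_arrow:
  assumes "g \<in> garrows G"
  shows "is_piso E (gdom G g, gcod G g, snd (snd (\<phi> g)))"
  using phi_eq[OF assms] by metis

lemma act_path:
  assumes "g \<in> garrows G" "is_fpath E (gdom G g) es"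
  shows "act \<phi> g (gdom G g, es) = (gcod G g, gact g es)"
    and "is_fpath E (gcod G g) (gact g es)"
    and "length (gact g es) = length es"
proof -
  have "(gdom G g, es) \<in> fpaths E (gdom G g)" using assms by (simp add: fpaths_def)
  then have "act \<phi> g (gdom G g, es) \<in> fpaths E (gcod G g)"
    "plen (act \<phi> g (gdom G g, es)) = length es"
    using piso_arrow[OF assms(1)] by (auto simp: is_piso_def act_def bij_betw_def plen_def)
  then show "act \<phi> g (gdom G g, es) = (gcod G g, gact g es)"
    "is_fpath E (gcod G g) (gact g es)" "length (gact g es) = length es"
    by (auto simp: fpaths_def gact_def plen_def)
qed

text \<open>Faithfulness: such arrows have equal extensional functions in \<open>PIso E\<close>, and
  \<phi> is injective. Identities between restrictions and inverses are derived this way.\<close>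

lemma arrow_eqI:
  assumes "g \<in> garrows G" "h \<in> garrows G" "gdom G g = gdom G h" "gcod G g = gcod G h"
    and "\<And>es. is_fpath E (gdom G g) es \<Longrightarrow> gact g es = gact h es"
  shows "g = h"
proof -
  have "act \<phi> g \<mu> = act \<phi> h \<mu>" if "\<mu> \<in> fpaths E (gdom G g)" for \<mu>
    using that act_path(1)[of g] act_path(1)[of h] assms by (auto simp: fpaths_def)
  then have "snd (snd (\<phi> g)) = snd (snd (\<phi> h))"
    using piso_arrow[OF assms(1)] piso_arrow[OF assms(2)] assms(3)
    by (intro extensionalityI[of _ "fpaths E (gdom G g)"]) (auto simp: is_piso_def act_def)
  then have "\<phi> g = \<phi> h" using phi_eq(1)[OF assms(1)] phi_eq(1)[OF assms(2)] assms(3,4) by metis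
  then show ?thesis using inj assms(1,2) by (auto simp: inj_on_def)
qed

lemma gact_Nil [simp]: "g \<in> garrows G \<Longrightarrow> gact g [] = []"
  using act_path(3)[of g "[]"] gdom_closed units_eq by auto

lemma gact_edge:
  assumes "g \<in> garrows G" "e \<in> arcs E" "head E e = gdom G g"
  obtains e' where "gact g [e] = [e']" "e' \<in> arcs E" "head E e' = gcod G g"
proof -
  have "is_fpath E (gdom G g) [e]" using assms by auto
  note act_path[OF assms(1) this]
  then show ?thesis using that by (cases "gact g [e]") auto
qed

lemma is_restriction_iff:
  assumes "g \<in> garrows G" "e \<in> arcs E" "head E e = gdom G g"
  shows "is_restriction E G \<phi> g e h \<longleftrightarrow> h \<in> garrows G \<and> gdom G h = tail E e \<and>
    gcod G h = path_end E (gcod G g) (gact g [e]) \<and>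
    (\<forall>es. is_fpath E (tail E e) es \<longrightarrow> gact g (e # es) = gact g [e] @ gact h es)"
proof -
  have e: "act \<phi> g (pedge E e) = (gcod G g, gact g [e])"
    using act_path(1)[of g "[e]"] assms by (simp add: pedge_def)
  have "act \<phi> g (pcat (pedge E e) \<mu>) = pcat (act \<phi> g (pedge E e)) (act \<phi> h \<mu>) \<longleftrightarrow>
      gact g (e # snd \<mu>) = gact g [e] @ gact h (snd \<mu>)"
    if \<mu>: "\<mu> \<in> fpaths E (tail E e)" and "gdom G h = tail E e" for \<mu>
  proof -
    obtain es where es: "\<mu> = (tail E e, es)" "is_fpath E (tail E e) es"
      using \<mu> by (auto simp: fpaths_def)
    then have "act \<phi> g (pcat (pedge E e) \<mu>) = (gcod G g, gact g (e # es))"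
      using act_path(1)[of g "e # es"] assms by (simp add: pcat_def pedge_def)
    moreover have "snd (act \<phi> h \<mu>) = gact h es" using that(2) by (simp add: gact_def es)
    ultimately show ?thesis by (simp add: e es pcat_def)
  qed
  then show ?thesis by (auto simp: is_restriction_def e fpaths_def)
qed

text \<open>\<open>restriction_unique\<close> makes the \<open>THE\<close> in
  \<open>restr_edge\<close> denote the arrow supplied by \<open>restriction_ex\<close>.\<close>

lemma res1:
  assumes "g \<in> garrows G" "e \<in> arcs E" "head E e = gdom G g"
  shows "res1 g e \<in> garrows G" "gdom G (res1 g e) = tail E e"
    "gcod G (res1 g e) = path_end E (gcod G g) (gact g [e])"
    "is_fpath E (tail E e) es \<Longrightarrow> gact g (e # es) = gact g [e] @ gact (res1 g e) es"
proof -
  have "\<exists>!h. is_restriction E G \<phi> g e h"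
    using restriction_ex[OF assms] restriction_unique by blast
  then have "is_restriction E G \<phi> g e (res1 g e)"
    unfolding restr_edge_def by (rule theI')
  then show "res1 g e \<in> garrows G" "gdom G (res1 g e) = tail E e"
    "gcod G (res1 g e) = path_end E (gcod G g) (gact g [e])"
    "is_fpath E (tail E e) es \<Longrightarrow> gact g (e # es) = gact g [e] @ gact (res1 g e) es"
    unfolding is_restriction_iff[OF assms] by auto
qed

lemma res1_eqI:
  assumes "g \<in> garrows G" "e \<in> arcs E" "head E e = gdom G g"
    and "h \<in> garrows G" "gdom G h = tail E e" "gcod G h = path_end E (gcod G g) (gact g [e])"
    and "\<And>es. is_fpath E (tail E e) es \<Longrightarrow> gact g (e # es) = gact g [e] @ gact h es"
  shows "res1 g e = h"
proof (rule arrow_eqI)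
  show "gact (res1 g e) es = gact h es" if "is_fpath E (gdom G (res1 g e)) es" for es
    using res1(2)[OF assms(1-3)] res1(4)[OF assms(1-3), of es] assms(7)[of es] that by simp
qed (use res1(1-3)[OF assms(1-3)] assms(4-6) in auto)

lemma res_closed:
  assumes "g \<in> garrows G" "is_fpath E (gdom G g) es"
  shows "res g es \<in> garrows G \<and> gdom G (res g es) = path_end E (gdom G g) es \<and>
    gcod G (res g es) = path_end E (gcod G g) (gact g es)"
  using assms
proof (induction es arbitrary: g)
  case (Cons e es)
  then show ?case using res1(1-3)[of g e] res1(4)[of g e es] by simp
qed simp

lemma gact_append:
  assumes "g \<in> garrows G" "is_fpath E (gdom G g) (es @ fs)"
  shows "gact g (es @ fs) = gact g es @ gact (res g es) fs"
  using assms
proof (induction es arbitrary: g)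
  case (Cons e es)
  then show ?case using res1(1,2)[of g e] res1(4)[of g e es] res1(4)[of g e "es @ fs"]
    by (simp add: is_fpath_append)
qed simp

lemma res_append: "res g (es @ fs) = res (res g es) fs"
  by (induction es arbitrary: g) auto

lemma gact_gone: "is_fpath E v es \<Longrightarrow> gact (gone G v) es = es"
  using hom is_fpath_verts[of v es] units_eq
  by (auto simp: gact_def act_def unital_groupoid_hom_def PIso_def gdom_gone fpaths_def)

lemma gact_gmult:
  assumes "g \<in> garrows G" "h \<in> garrows G" "gdom G g = gcod G h" "is_fpath E (gdom G h) es"
  shows "gact (gmult G g h) es = gact g (gact h es)"
proof -
  have "\<phi> (gmult G g h) = gmult (PIso E) (\<phi> g) (\<phi> h)"
    using hom assms by (auto simp: unital_groupoid_hom_def)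
  also have "snd (snd \<dots>) = compose (fpaths E (gdom G h)) (snd (snd (\<phi> g))) (snd (snd (\<phi> h)))"
    using phi_eq(3)[OF assms(2)] by (auto simp: PIso_def split: prod.splits)
  finally have "act \<phi> (gmult G g h) (gdom G h, es) = act \<phi> g (act \<phi> h (gdom G h, es))"
    using assms by (simp add: act_def compose_def fpaths_def)
  then show ?thesis
    using act_path(1)[OF assms(2,4)] assms
    by (simp add: gact_def[of "gmult G g h"] gact_def[of g] gdom_gmult)
qed

lemma gact_ginv:
  assumes "g \<in> garrows G" "is_fpath E (gdom G g) es"
  shows "gact (ginv G g) (gact g es) = es"
  using gact_gmult[of "ginv G g" g es] assms
  by (simp add: ginv_closed gdom_ginv gmult_ginv_left gact_gone)

lemma ginv_ginv:
  assumes "g \<in> garrows G"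
  shows "ginv G (ginv G g) = g"
proof (rule arrow_eqI)
  show "gact (ginv G (ginv G g)) es = gact g es" if "is_fpath E (gdom G (ginv G (ginv G g))) es" for es
    using that assms gact_ginv[of "ginv G g" "gact g es"] act_path[of g es]
    by (simp add: ginv_closed gdom_ginv gcod_ginv gact_ginv)
qed (auto simp: assms ginv_closed gdom_ginv gcod_ginv)

lemma res1_gone:
  assumes "e \<in> arcs E"
  shows "res1 (gone G (head E e)) e = gone G (tail E e)"
  using assms units_eq by (intro res1_eqI) (auto simp: gone_closed gdom_gone gcod_gone gact_gone)

lemma res_gone:
  assumes "is_fpath E v es"
  shows "res (gone G v) es = gone G (path_end E v es)"
  using assms
proof (induction es arbitrary: v)
  case (Cons e es)
  then show ?case using res1_gone[of e] by auto
qed simp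

text \<open>If \<open>res1 g e\<close> sends \<open>fs\<close> to \<open>es\<close>, then
  \<open>g\<close> sends \<open>e # fs\<close> to \<open>e' # es\<close>; reading this backwards
  gives the restriction of the inverse. It lets a set closed under restriction be enlarged by its
  inverses.\<close>

lemma res1_ginv:
  assumes g: "g \<in> garrows G" and e: "e \<in> arcs E" "head E e = gdom G g" and e': "gact g [e] = [e']"
  shows "res1 (ginv G g) e' = ginv G (res1 g e)"
proof -
  have e'_arc: "e' \<in> arcs E" "head E e' = gcod G g"
    using gact_edge[OF g e] e' by auto
  have inv_e': "gact (ginv G g) [e'] = [e]"
    using gact_ginv[OF g, of "[e]"] e e' by simp
  let ?h = "res1 g e"
  have h: "?h \<in> garrows G" "gdom G ?h = tail E e" "gcod G ?h = tail E e'"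
    using res1(1-3)[OF g e] e' by auto
  show ?thesis
  proof (rule res1_eqI)
    fix es assume es: "is_fpath E (tail E e') es"
    let ?fs = "gact (ginv G ?h) es"
    have fs: "is_fpath E (tail E e) ?fs"
      using act_path(2)[of "ginv G ?h" es] es h by (simp add: ginv_closed gdom_ginv gcod_ginv)
    have "gact ?h ?fs = es"
      using gact_ginv[of "ginv G ?h" es] es h by (simp add: ginv_closed gdom_ginv ginv_ginv)
    then have "gact g (e # ?fs) = e' # es"
      using res1(4)[OF g e fs] e' by simp
    then show "gact (ginv G g) (e' # es) = gact (ginv G g) [e'] @ ?fs"
      using gact_ginv[OF g, of "e # ?fs"] e fs inv_e' by simp
  qed (use g e h e'_arc inv_e' in \<open>auto simp: ginv_closed gdom_ginv gcod_ginv\<close>)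
qed

section \<open>Contraction and regularity with uniform bounds\<close>

text \<open>A finite stand-in for the nucleus. The last clause speaks of one length only; closure
  under \<open>res1\<close> extends it to all longer paths.\<close>

definition absorbing :: "'g set \<Rightarrow> bool" where
  "absorbing N \<longleftrightarrow> finite N \<and> N \<subseteq> garrows G \<and> gone G ` verts E \<subseteq> N \<and> ginv G ` N \<subseteq> N \<and>
    (\<forall>g\<in>N. \<forall>e\<in>arcs E. head E e = gdom G g \<longrightarrow> res1 g e \<in> N) \<and>
    (\<forall>g\<in>garrows G. \<exists>n. \<forall>es. is_fpath E (gdom G g) es \<and> length es = n \<longrightarrow> res g es \<in> N)"

text \<open>The condition \<open>contracting\<close> is void for \<open>g \<in> F\<close> (take \<open>n = 0\<close>), so it has to be applied to
  the restrictions of \<open>g\<close> to single edges in order to see that a path returns to \<open>F\<close> within a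
  bounded number of steps.\<close>

lemma finite_restrictions:
  assumes fin: "finite (arcs E)" "finite F" and F: "F \<subseteq> garrows G"
    and n: "\<And>g es. \<lbrakk>g \<in> garrows G; is_fpath E (gdom G g) es; length es = n g\<rbrakk> \<Longrightarrow> res g es \<in> F"
  shows "finite {res g es | g es. g \<in> F \<and> is_fpath E (gdom G g) es}" (is "finite ?R")
proof -
  have "finite ((\<lambda>(g, e). Suc (n (res1 g e))) ` (F \<times> arcs E))"
    using fin by blast
  \<comment> \<open>A uniform bound on the number of edges after which a restriction is back in
    \<open>F\<close>; the successor counts the edge \<open>e\<close>.\<close>
  then obtain B where B: "\<And>g e. \<lbrakk>g \<in> F; e \<in> arcs E\<rbrakk> \<Longrightarrow> Suc (n (res1 g e)) \<le> B"
    unfolding finite_nat_set_iff_bounded_le by auto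
  let ?A = "(\<lambda>(g, es). res g es) ` (F \<times> {es. set es \<subseteq> arcs E \<and> length es \<le> B})"
  have "res g es \<in> ?A" if "g \<in> F" "is_fpath E (gdom G g) es" for g es
    using that
  proof (induction "length es" arbitrary: g es rule: less_induct)
    case less
    show ?case
    proof (cases "length es \<le> B")
      case True
      then show ?thesis using less.prems is_fpath_set[OF less.prems(2)]
        by (intro image_eqI[of _ _ "(g, es)"]) auto
    next
      case False
      then obtain e fs where es: "es = e # fs" by (cases es) auto
      with less have e: "g \<in> garrows G" "e \<in> arcs E" "head E e = gdom G g" "is_fpath E (tail E e) fs"
        using F by auto
      let ?k = "n (res1 g e)"
      have k: "?k < length fs" using B[OF less(2) e(2)] False es by simp
      have take: "is_fpath E (tail E e) (take ?k fs)"
        "is_fpath E (path_end E (tail E e) (take ?k fs)) (drop ?k fs)"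
        using e(4) is_fpath_append[of "tail E e" "take ?k fs" "drop ?k fs"] by auto
      \<comment> \<open>Once back in \<open>F\<close>, only the strictly shorter remainder of the
        path matters, and the induction hypothesis covers it.\<close>
      have "res (res1 g e) (take ?k fs) \<in> F"
        using n[of "res1 g e" "take ?k fs"] k take res1(1,2)[OF e(1-3)] by simp
      moreover have "gdom G (res (res1 g e) (take ?k fs)) = path_end E (tail E e) (take ?k fs)"
        using res_closed[of "res1 g e" "take ?k fs"] take res1(1,2)[OF e(1-3)] by simp
      ultimately have "res (res (res1 g e) (take ?k fs)) (drop ?k fs) \<in> ?A"
        using less(1)[of "drop ?k fs"] k take es by simp
      then show ?thesis by (simp add: es flip: res_append)
    qed
  qed
  then have "?R \<subseteq> ?A" by auto
  moreover have "finite ?A"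
    using finite_lists_length_le[OF fin(1)] fin(2) by blast
  ultimately show ?thesis by (rule finite_subset)
qed

text \<open>The restrictions of \<open>F\<close> along all paths form a finite set \<open>R\<close>
  closed under restriction. Adding inverses and units preserves this closure by
  \<open>res1_ginv\<close> and \<open>res1_gone\<close>.\<close>

lemma ex_absorbing:
  assumes fin: "finite (verts E)" "finite (arcs E)" and "contracting E G \<phi>"
  obtains N where "absorbing N"
proof -
  obtain F where F: "finite F" "F \<subseteq> garrows G"
    and F_ex: "\<forall>g\<in>garrows G. \<exists>n. {restr E G \<phi> g \<mu> | \<mu>. \<mu> \<in> fpaths E (gdom G g) \<and> plen \<mu> = n} \<subseteq> F"
    using assms(3) by (auto simp: contracting_def)
  have "\<exists>n. \<forall>es. is_fpath E (gdom G g) es \<and> length es = n \<longrightarrow> res g es \<in> F" if g: "g \<in> garrows G" for g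
  proof -
    obtain n where n: "{restr E G \<phi> g \<mu> | \<mu>. \<mu> \<in> fpaths E (gdom G g) \<and> plen \<mu> = n} \<subseteq> F"
      using F_ex g by blast
    have "restr E G \<phi> g (gdom G g, es) \<in> F" if "is_fpath E (gdom G g) es" "length es = n" for es
    proof -
      have "(gdom G g, es) \<in> fpaths E (gdom G g)" "plen (gdom G g, es) = n"
        using that by (auto simp: fpaths_def plen_def)
      then show ?thesis using n by blast
    qed
    then show ?thesis by (auto simp: restr_def)
  qed
  then obtain n where n: "\<And>g es. \<lbrakk>g \<in> garrows G; is_fpath E (gdom G g) es; length es = n g\<rbrakk> \<Longrightarrow> res g es \<in> F"
    by metis
  define R where "R = {res g es | g es. g \<in> F \<and> is_fpath E (gdom G g) es}"
  have R: "finite R" unfolding R_def by (rule finite_restrictions[OF fin(2) F n])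
  have R_arrows: "R \<subseteq> garrows G" using res_closed F by (auto simp: R_def)
  have "g \<in> R" if "g \<in> F" for g
    unfolding R_def using that F gdom_closed units_eq
    by (intro CollectI exI[of _ g] exI[of _ "[]"]) auto
  then have FR: "F \<subseteq> R" by blast
  have R_res1: "res1 g e \<in> R" if "g \<in> R" and e: "e \<in> arcs E" "head E e = gdom G g" for g e
  proof -
    obtain g' es where "g' \<in> F" "is_fpath E (gdom G g') es" "g = res g' es"
      using \<open>g \<in> R\<close> by (auto simp: R_def)
    moreover from this have "is_fpath E (gdom G g') (es @ [e])"
      using e res_closed[of g' es] F by (auto simp: is_fpath_append)
    moreover have "res1 g e = res g' (es @ [e])"
      using calculation by (simp add: res_append)
    ultimately show ?thesis unfolding R_def by blast
  qed
  define N where "N = R \<union> ginv G ` R \<union> gone G ` verts E"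
  have ginv_gone: "ginv G (gone G v) = gone G v" if "v \<in> verts E" for v
  proof (rule arrow_eqI)
    fix es assume "is_fpath E (gdom G (ginv G (gone G v))) es"
    then show "gact (ginv G (gone G v)) es = gact (gone G v) es"
      using gact_ginv[of "gone G v" es] that
      by (simp add: units_eq gone_closed gdom_gone gcod_gone gdom_ginv gact_gone)
  qed (use that units_eq in \<open>auto simp: gone_closed gdom_gone gcod_gone gdom_ginv gcod_ginv ginv_closed\<close>)
  have "absorbing N"
    unfolding absorbing_def
  proof (intro conjI ballI impI)
    show "finite N" using R fin by (simp add: N_def)
    show "N \<subseteq> garrows G" using R_arrows units_eq by (auto simp: N_def ginv_closed gone_closed)
    show "gone G ` verts E \<subseteq> N" by (simp add: N_def)
    show "ginv G ` N \<subseteq> N" using R_arrows ginv_ginv ginv_gone by (auto simp: N_def)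
    show "res1 g e \<in> N" if "g \<in> N" and e: "e \<in> arcs E" "head E e = gdom G g" for g e
    proof -
      consider "g \<in> R" | h where "h \<in> R" "g = ginv G h" | v where "v \<in> verts E" "g = gone G v"
        using \<open>g \<in> N\<close> by (auto simp: N_def)
      then show ?thesis
      proof cases
        case 1
        then show ?thesis using R_res1 e by (simp add: N_def)
      next
        case 2
        have h: "h \<in> garrows G" using 2 R_arrows by auto
        have e_h: "head E e = gcod G h" using e 2 h by (simp add: gdom_ginv)
        \<comment> \<open>To apply \<open>res1_ginv\<close> to \<open>h\<close>, the edge
          \<open>e\<close> has to be presented as the image under \<open>h\<close> of an edge
          \<open>a\<close>.\<close>
        obtain a where a: "gact (ginv G h) [e] = [a]" "a \<in> arcs E" "head E a = gdom G h"
          using gact_edge[of "ginv G h" e] e_h h e by (auto simp: ginv_closed gdom_ginv gcod_ginv)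
        have "gact h [a] = [e]"
          using gact_ginv[of "ginv G h" "[e]"] h e e_h a by (simp add: ginv_closed gdom_ginv ginv_ginv)
        then have "res1 g e = ginv G (res1 h a)"
          using res1_ginv[OF h a(2,3)] 2 by simp
        then show ?thesis using R_res1[OF 2(1) a(2,3)] by (simp add: N_def)
      next
        case 3
        then have "v = head E e" using e units_eq by (simp add: gdom_gone)
        then show ?thesis using 3 res1_gone[of e] e by (simp add: N_def)
      qed
    qed
    show "\<exists>n. \<forall>es. is_fpath E (gdom G g) es \<and> length es = n \<longrightarrow> res g es \<in> N" if "g \<in> garrows G" for g
      using n[OF that] FR by (intro exI[of _ "n g"]) (auto simp: N_def)
  qed
  then show ?thesis by (rule that)
qed

lemma absorbing_res:
  assumes "absorbing N" "g \<in> N" "is_fpath E (gdom G g) es"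
  shows "res g es \<in> N"
  using assms(2,3)
proof (induction es arbitrary: g)
  case (Cons e es)
  then have "g \<in> garrows G" "res1 g e \<in> N" using assms(1) by (auto simp: absorbing_def)
  then show ?case using Cons res1(2)[of g e] by auto
qed simp

text \<open>Once a restriction has entered \<open>N\<close> it stays there, so the maximum of the
  finitely many entry lengths serves all of \<open>S\<close>.\<close>

lemma absorbing_finite_set:
  assumes N: "absorbing N" and S: "finite S" "S \<subseteq> garrows G"
  obtains m where "\<And>g es. \<lbrakk>g \<in> S; is_fpath E (gdom G g) es; m \<le> length es\<rbrakk> \<Longrightarrow> res g es \<in> N"
proof -
  have "\<forall>g\<in>S. \<exists>n. \<forall>es. is_fpath E (gdom G g) es \<and> length es = n \<longrightarrow> res g es \<in> N"
    using N S by (auto simp: absorbing_def)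
  then obtain n where n: "\<And>g es. \<lbrakk>g \<in> S; is_fpath E (gdom G g) es; length es = n g\<rbrakk> \<Longrightarrow> res g es \<in> N"
    by metis
  obtain m where m: "\<And>g. g \<in> S \<Longrightarrow> n g \<le> m"
    using finite_nat_set_iff_bounded_le[of "n ` S"] S by auto
  have "res g es \<in> N" if "g \<in> S" "is_fpath E (gdom G g) es" "m \<le> length es" for g es
  proof -
    have take: "is_fpath E (gdom G g) (take (n g) es)"
      "is_fpath E (path_end E (gdom G g) (take (n g) es)) (drop (n g) es)"
      using that(2) is_fpath_append[of _ "take (n g) es" "drop (n g) es"] by auto
    have "res g (take (n g) es) \<in> N"
      using n[OF that(1) take(1)] m[OF that(1)] that(3) by simp
    then have "res (res g (take (n g) es)) (drop (n g) es) \<in> N"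
      using absorbing_res[OF N] take res_closed[of g "take (n g) es"] that(1) S by auto
    then show ?thesis by (simp flip: res_append)
  qed
  then show ?thesis using that by blast
qed

text \<open>Koenig's lemma turns regularity, a condition on infinite paths, into a uniform bound.\<close>

definition trivial_beyond :: "'g \<Rightarrow> nat \<Rightarrow> bool" where
  "trivial_beyond g m \<longleftrightarrow> (\<forall>es. is_fpath E (gdom G g) es \<and> m \<le> length es \<and> gact g es = es
     \<longrightarrow> res g es = gone G (path_end E (gdom G g) es))"

text \<open>The branching step: only finitely many edges are fixed by \<open>g\<close>, so the
  successor of their largest bound works. Hence an arrow without a bound has such a restriction
  along a fixed edge.\<close>

lemma trivial_beyond_step:
  assumes fin: "finite (arcs E)" and g: "g \<in> garrows G"
    and res: "\<And>e. \<lbrakk>e \<in> arcs E; head E e = gdom G g; gact g [e] = [e]\<rbrakk> \<Longrightarrow> \<exists>m. trivial_beyond (res1 g e) m"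
  shows "\<exists>m. trivial_beyond g m"
proof -
  let ?A = "{e \<in> arcs E. head E e = gdom G g \<and> gact g [e] = [e]}"
  have "\<forall>e\<in>?A. \<exists>m. trivial_beyond (res1 g e) m" using res by simp
  from bchoice[OF this] obtain n where n: "\<And>e. e \<in> ?A \<Longrightarrow> trivial_beyond (res1 g e) (n e)"
    by blast
  obtain m where m: "\<And>e. e \<in> ?A \<Longrightarrow> n e \<le> m"
    using finite_nat_set_iff_bounded_le[of "n ` ?A"] fin by auto
  have "trivial_beyond g (Suc m)"
    unfolding trivial_beyond_def
  proof (intro allI impI)
    fix es assume es: "is_fpath E (gdom G g) es \<and> Suc m \<le> length es \<and> gact g es = es"
    then obtain e fs where Cons: "es = e # fs" by (cases es) auto
    with es have e: "e \<in> arcs E" "head E e = gdom G g" and fs: "is_fpath E (tail E e) fs" by auto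
    obtain e' where e': "gact g [e] = [e']" by (rule gact_edge[OF g e])
    have "gact g es = e' # gact (res1 g e) fs" using res1(4)[OF g e fs] e' Cons by simp
    with es Cons e' have fixed: "gact g [e] = [e]" "gact (res1 g e) fs = fs" by auto
    then have "trivial_beyond (res1 g e) (n e)" "n e \<le> m" using n[of e] m[of e] e by auto
    then show "res g es = gone G (path_end E (gdom G g) es)"
      using fs fixed es Cons res1(2)[OF g e] by (auto simp: trivial_beyond_def)
  qed
  then show ?thesis ..
qed

text \<open>An arrow without a bound starts an infinite fixed path along which no restriction has a
  bound. Regularity makes one of these restrictions a unit, and a unit has bound 0.\<close>

lemma regular_trivial_beyond:
  assumes fin: "finite (arcs E)" and reg: "regular E G \<phi>" and g: "g \<in> garrows G"
  shows "\<exists>m. trivial_beyond g m"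
proof (rule ccontr)
  let ?bad = "\<lambda>g. g \<in> garrows G \<and> (\<nexists>m. trivial_beyond g m)"
  let ?step = "\<lambda>g h e. e \<in> arcs E \<and> head E e = gdom G g \<and> gact g [e] = [e] \<and> h = res1 g e"
  assume "\<nexists>m. trivial_beyond g m"
  then have bad_g: "?bad g" using g by simp
  have next_bad: "\<exists>h. ?bad h \<and> (\<exists>e. ?step k h e)" if "?bad k" for k
    using trivial_beyond_step[OF fin, of k] res1(1)[of k] that by blast
  \<comment> \<open>The clause for \<open>n = 0\<close> pins the start of the chosen sequence to
    \<open>g\<close>.\<close>
  have "\<exists>h. \<forall>n. (?bad (h n) \<and> (n = 0 \<longrightarrow> h n = g)) \<and> (\<exists>e. ?step (h n) (h (Suc n)) e)"
    by (rule dependent_nat_choice) (use bad_g next_bad in auto)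
  then obtain h where h': "\<forall>n. (?bad (h n) \<and> (n = 0 \<longrightarrow> h n = g)) \<and> (\<exists>e. ?step (h n) (h (Suc n)) e)"
    by blast
  then have h: "h 0 = g" "\<And>i. ?bad (h i)" by blast+
  have "\<forall>i. \<exists>e. ?step (h i) (h (Suc i)) e" using h' by blast
  then obtain y where y: "\<And>i. ?step (h i) (h (Suc i)) (y i)" by metis
  have y_inf: "y \<in> right_inf E"
    using y h(2) res1(2) by (simp add: right_inf_def)
  have init: "is_fpath E (gdom G g) (map y [0..<n]) \<and> gact g (map y [0..<n]) = map y [0..<n] \<and>
      res g (map y [0..<n]) = h n" for n
  proof (induction n)
    case 0
    then show ?case using g h(1) gdom_closed units_eq by simp
  next
    case (Suc n)
    then have "is_fpath E (gdom G g) (map y [0..<n] @ [y n])"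
      using y[of n] res_closed[of g "map y [0..<n]"] g by (auto simp: is_fpath_append)
    then show ?case using Suc y[of n] gact_append[OF g, of "map y [0..<n]" "[y n]"]
      by (auto simp: res_append)
  qed
  have y0: "head E (y 0) = gdom G g" using y[of 0] h(1) by simp
  then have "right_act E \<phi> g y = y"
    using init[of "Suc _"] by (simp add: right_act_def right_init_def gact_def fun_eq_iff nth_append)
  then obtain n where "restr E G \<phi> g (right_init E y n) = gone G (psource E (right_init E y n))"
    using reg g y_inf y0 unfolding regular_def by blast
  then have "h n = gone G (path_end E (gdom G g) (map y [0..<n]))"
    using init[of n] y0 by (simp add: restr_def right_init_def)
  moreover have "path_end E (gdom G g) (map y [0..<n]) \<in> verts E"
    using init[of n] path_end_in_verts by blast
  ultimately have "trivial_beyond (h n) 0"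
    using units_eq by (auto simp: trivial_beyond_def res_gone gdom_gone)
  then show False using h(2) by blast
qed

end

section \<open>Asymptotic equivalence through an absorbing set\<close>

text \<open>The edge list of \<open>left_final E x n\<close>, of length \<open>n + 1\<close>.
  Increasing \<open>n\<close> adds edges in front, while \<open>shift\<close> removes the last
  one.\<close>

definition seg :: "(nat \<Rightarrow> 'e) \<Rightarrow> nat \<Rightarrow> 'e list" where
  "seg x n = rev (map x [0..<Suc n])"

lemma seg_simps [simp]: "seg x 0 = [x 0]" "seg x (Suc n) = x (Suc n) # seg x n"
  by (simp_all add: seg_def)

lemma length_seg [simp]: "length (seg x n) = Suc n"
  by (simp add: seg_def)

lemma seg_shift: "seg x (Suc n) = seg (shift x) n @ [x 0]"
  by (induction n) (auto simp: shift_def)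

lemma seg_add: "\<exists>pre. length pre = m \<and> seg x (n + m) = pre @ seg x n"
proof (induction m)
  case (Suc m)
  then obtain pre where "length pre = m" "seg x (n + m) = pre @ seg x n" by blast
  then show ?case by (intro exI[of _ "x (Suc (n + m)) # pre"]) auto
qed simp

lemma seg_eq_iff: "seg x n = seg y n \<longleftrightarrow> (\<forall>i\<le>n. x i = y i)"
  by (induction n) (auto simp: le_Suc_eq)

lemma path_end_seg [simp]: "path_end E v (seg x n) = tail E (x 0)"
  by (induction n arbitrary: v) auto

lemma is_fpath_segD: "is_fpath E v (seg x n) \<Longrightarrow> head E (x n) = v"
  by (cases n) auto

lemma (in wf_digraph) is_fpath_seg:
  "x \<in> left_inf G \<Longrightarrow> is_fpath G (head G (x n)) (seg x n)"
  by (induction n) (auto simp: left_inf_def)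

lemma shift_left_inf: "x \<in> left_inf E \<Longrightarrow> shift x \<in> left_inf E"
  by (auto simp: left_inf_def shift_def)

lemma shift_case_nat [simp]: "shift (case_nat e x) = x"
  by (simp add: shift_def)

lemma case_nat_left_inf:
  "\<lbrakk>x \<in> left_inf E; e \<in> arcs E; tail E (x 0) = head E e\<rbrakk> \<Longrightarrow> case_nat e x \<in> left_inf E"
  by (auto simp: left_inf_def split: nat.split)

context self_similar_action
begin

text \<open>One level of \<open>ae_rel\<close>. Keeping the pool \<open>S\<close> of arrows explicit
  allows pools to be multiplied, inverted and contracted.\<close>

definition link :: "'g set \<Rightarrow> nat \<Rightarrow> (nat \<Rightarrow> 'e) \<Rightarrow> (nat \<Rightarrow> 'e) \<Rightarrow> bool" where
  "link S n x y \<longleftrightarrow> (\<exists>g\<in>S. gdom G g = head E (x n) \<and> gact g (seg x n) = seg y n)"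

lemma link_mono: "\<lbrakk>S \<subseteq> T; link S n x y\<rbrakk> \<Longrightarrow> link T n x y"
  by (auto simp: link_def)

definition gmults :: "'g set \<Rightarrow> 'g set \<Rightarrow> 'g set" where
  "gmults S T = {gmult G g h | g h. g \<in> S \<and> h \<in> T \<and> gdom G g = gcod G h}"

lemma finite_gmults: "\<lbrakk>finite S; finite T\<rbrakk> \<Longrightarrow> finite (gmults S T)"
  by (rule finite_subset[of _ "(\<lambda>(g, h). gmult G g h) ` (S \<times> T)"]) (auto simp: gmults_def)

lemma gmults_closed: "\<lbrakk>S \<subseteq> garrows G; T \<subseteq> garrows G\<rbrakk> \<Longrightarrow> gmults S T \<subseteq> garrows G"
  by (auto simp: gmults_def intro!: gmult_closed)

lemma gcod_link:
  assumes "g \<in> garrows G" "x \<in> left_inf E" "gdom G g = head E (x n)" "gact g (seg x n) = seg y n"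
  shows "gcod G g = head E (y n)"
  using act_path(2)[OF assms(1), of "seg x n"] is_fpath_seg[OF assms(2), of n] assms
  by (auto dest: is_fpath_segD)

text \<open>The longer segment is the shorter one with \<open>m\<close> edges in front, so
  restricting the arrow along these edges links the shorter segments.\<close>

lemma link_contract:
  assumes S: "S \<subseteq> garrows G" and x: "x \<in> left_inf E"
    and link: "link S (n + m) x y"
    and T: "\<And>g es. \<lbrakk>g \<in> S; is_fpath E (gdom G g) es; length es = m\<rbrakk> \<Longrightarrow> res g es \<in> T"
  shows "link T n x y"
proof -
  obtain g where g: "g \<in> S" "gdom G g = head E (x (n + m))" "gact g (seg x (n + m)) = seg y (n + m)"
    using link by (auto simp: link_def)
  obtain pre where pre: "length pre = m" "seg x (n + m) = pre @ seg x n" using seg_add by blast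
  obtain pre' where pre': "length pre' = m" "seg y (n + m) = pre' @ seg y n" using seg_add by blast
  have path: "is_fpath E (gdom G g) (pre @ seg x n)"
    using is_fpath_seg[OF x, of "n + m"] g pre by simp
  have garr: "g \<in> garrows G" using g S by blast
  have pre_path: "is_fpath E (gdom G g) pre" using path by (simp add: is_fpath_append)
  have "gact g pre @ gact (res g pre) (seg x n) = pre' @ seg y n"
    using gact_append[OF garr path] g pre pre' by simp
  then have "gact (res g pre) (seg x n) = seg y n"
    using act_path(3)[OF garr pre_path] pre pre' by simp
  moreover have "gdom G (res g pre) = head E (x n)"
    using path res_closed[OF garr pre_path] by (auto simp: is_fpath_append dest: is_fpath_segD)
  ultimately show ?thesis using T[OF g(1) pre_path pre(1)] by (auto simp: link_def)
qed

lemma link_comp: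
  assumes "S \<subseteq> garrows G" "T \<subseteq> garrows G" "x \<in> left_inf E" "link S n x y" "link T n y z"
  shows "link (gmults T S) n x z"
proof -
  obtain g where g: "g \<in> S" "gdom G g = head E (x n)" "gact g (seg x n) = seg y n"
    using assms by (auto simp: link_def)
  obtain h where h: "h \<in> T" "gdom G h = head E (y n)" "gact h (seg y n) = seg z n"
    using assms by (auto simp: link_def)
  have arr: "g \<in> garrows G" "h \<in> garrows G" using g h assms by auto
  have "gdom G h = gcod G g" using gcod_link[OF arr(1) assms(3) g(2,3)] h by simp
  moreover from this have "gact (gmult G h g) (seg x n) = seg z n"
    using gact_gmult[OF arr(2,1)] is_fpath_seg[OF assms(3)] g h by simp
  moreover have "gdom G (gmult G h g) = head E (x n)"
    using gdom_gmult[OF arr(2,1)] calculation g by simp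
  ultimately show ?thesis using g h by (auto simp: link_def gmults_def)
qed

lemma link_sym:
  assumes "S \<subseteq> garrows G" "x \<in> left_inf E" "link S n x y"
  shows "link (ginv G ` S) n y x"
proof -
  obtain g where g: "g \<in> S" "gdom G g = head E (x n)" "gact g (seg x n) = seg y n"
    using assms by (auto simp: link_def)
  have arr: "g \<in> garrows G" using g assms by auto
  have "gact (ginv G g) (seg y n) = seg x n"
    using gact_ginv[OF arr, of "seg x n"] is_fpath_seg[OF assms(2), of n] g by simp
  then show ?thesis
    using gcod_link[OF arr assms(2) g(2,3)] g arr
    by (auto simp: link_def gdom_ginv intro!: bexI[of _ g])
qed

text \<open>The range of a finitely valued sequence is a finite pool; conversely a sequence is
  chosen from the pool level by level. \<open>gcod_link\<close> accounts for the ranges stored in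
  \<open>left_final\<close>.\<close>

lemma ae_rel_iff:
  "(x, y) \<in> ae_rel E G \<phi> \<longleftrightarrow> x \<in> left_inf E \<and> y \<in> left_inf E \<and>
    (\<exists>S. finite S \<and> S \<subseteq> garrows G \<and> (\<forall>n. link S n x y))"
proof -
  have act_iff: "act \<phi> g (left_final E x n) = left_final E y n \<longleftrightarrow> gact g (seg x n) = seg y n"
    if "x \<in> left_inf E" "g \<in> garrows G" "gdom G g = head E (x n)" for g n
  proof -
    have "act \<phi> g (left_final E x n) = (gcod G g, gact g (seg x n))"
      using act_path(1)[of g "seg x n"] that is_fpath_seg[of x n]
      by (simp add: left_final_def seg_def)
    moreover have "left_final E y n = (head E (y n), seg y n)"
      by (simp add: left_final_def seg_def)
    ultimately show ?thesis using gcod_link[OF that(2,1,3), of y] by auto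
  qed
  show ?thesis (is "?L = ?R")
  proof
    assume ?L
    then obtain g :: "nat \<Rightarrow> 'g" where g: "x \<in> left_inf E" "y \<in> left_inf E" "finite (range g)"
      "\<And>n. g n \<in> garrows G" "\<And>n. gdom G (g n) = head E (x n)"
      "\<And>n. act \<phi> (g n) (left_final E x n) = left_final E y n"
      by (auto simp: ae_rel_def)
    then have "link (range g) n x y" for n
      using act_iff[of "g n" n] by (auto simp: link_def)
    then show ?R using g by (intro conjI exI[of _ "range g"]) auto
  next
    assume R: ?R
    then obtain S where S: "finite S" "S \<subseteq> garrows G" "\<And>n. link S n x y" by blast
    then have "\<forall>n. \<exists>g. g \<in> S \<and> gdom G g = head E (x n) \<and> gact g (seg x n) = seg y n"
      by (auto simp: link_def)
    from choice[OF this] obtain g where g: "\<And>n. g n \<in> S \<and> gdom G (g n) = head E (x n) \<and>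
      gact (g n) (seg x n) = seg y n" by blast
    then have "finite (range g)" using finite_subset[of "range g" S] S by blast
    moreover have "g n \<in> garrows G \<and> gdom G (g n) = head E (x n) \<and>
        act \<phi> (g n) (left_final E x n) = left_final E y n" for n
      using act_iff[of "g n" n] R g[of n] S(2) by blast
    ultimately show ?L using R by (auto simp: ae_rel_def)
  qed
qed

text \<open>The same arrow works, because the action respects initial segments and only the last
  edge is dropped.\<close>

lemma link_shift:
  assumes S: "S \<subseteq> garrows G" and x: "x \<in> left_inf E" and link: "link S (Suc n) x y"
  shows "link S n (shift x) (shift y)"
proof -
  obtain g where g: "g \<in> S" "gdom G g = head E (x (Suc n))" "gact g (seg x (Suc n)) = seg y (Suc n)"
    using link by (auto simp: link_def)
  have arr: "g \<in> garrows G" using g S by blast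
  have path: "is_fpath E (gdom G g) (seg (shift x) n @ [x 0])"
    using is_fpath_seg[OF x, of "Suc n"] g by (simp only: seg_shift)
  have "gact g (seg (shift x) n) @ gact (res g (seg (shift x) n)) [x 0] = seg (shift y) n @ [y 0]"
    using gact_append[OF arr path] g(3) by (simp only: seg_shift)
  moreover have "length (gact g (seg (shift x) n)) = Suc n"
    using act_path(3)[OF arr, of "seg (shift x) n"] path by (simp add: is_fpath_append)
  ultimately have "gact g (seg (shift x) n) = seg (shift y) n" by simp
  then show ?thesis using g by (auto simp: link_def shift_def)
qed

text \<open>The converse of \<open>link_shift\<close>: applying the same arrow to one more edge
  produces the edge that has to be attached to \<open>y\<close>.\<close>

lemma link_extend:
  assumes x: "x \<in> left_inf E" and y: "y \<in> left_inf E" and g: "g \<in> garrows G"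
    and "gdom G g = head E (shift x n)" "gact g (seg (shift x) n) = seg y n"
  obtains e where "e \<in> arcs E" "case_nat e y \<in> left_inf E"
    "gact g (seg x (Suc n)) = seg (case_nat e y) (Suc n)"
proof -
  have path: "is_fpath E (gdom G g) (seg (shift x) n @ [x 0])"
    using is_fpath_seg[OF x, of "Suc n"] assms(4) by (simp only: seg_shift) (simp add: shift_def)
  have eq: "gact g (seg x (Suc n)) = seg y n @ gact (res g (seg (shift x) n)) [x 0]"
    using gact_append[OF g path] assms(5) by (simp only: seg_shift)
  have "length (gact g (seg x (Suc n))) = Suc (Suc n)"
    using act_path(3)[OF g path] by (simp only: seg_shift) simp
  then obtain e where e: "gact (res g (seg (shift x) n)) [x 0] = [e]"
    unfolding eq by (cases "gact (res g (seg (shift x) n)) [x 0]") auto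
  have "is_fpath E (gcod G g) (seg y n @ [e])"
    using act_path(2)[OF g path] eq e by (simp only: seg_shift)
  then have "e \<in> arcs E" "tail E (y 0) = head E e" by (auto simp: is_fpath_append)
  moreover have "seg (case_nat e y) (Suc n) = seg y n @ [e]" by (subst seg_shift) simp
  ultimately show ?thesis using that case_nat_left_inf[OF y] eq e by simp
qed

end

section \<open>Asymptotic equivalence classes and the induced shift\<close>

locale contracting_action = self_similar_action E G \<phi>
  for E :: "('v, 'e) pre_digraph" and G :: "('v, 'g) groupoid" and \<phi> :: "'g \<Rightarrow> ('v, 'e) piso" +
  fixes N :: "'g set"
  assumes finite_arcs: "finite (arcs E)"
    and no_sources: "no_sources E"
    and regular: "regular E G \<phi>"
    and absorbing: "absorbing N"
begin

lemma N_finite: "finite N" and N_arrows: "N \<subseteq> garrows G"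
  using absorbing by (auto simp: absorbing_def)

lemma link_N_refl: "x \<in> left_inf E \<Longrightarrow> link N n x x"
proof -
  assume x: "x \<in> left_inf E"
  then have "head E (x n) \<in> verts E" by (simp add: left_inf_def)
  then show ?thesis
    using absorbing units_eq gact_gone[OF is_fpath_seg[OF x]]
    by (auto simp: link_def absorbing_def gdom_gone intro!: bexI[of _ "gone G (head E (x n))"])
qed

lemma link_N_sym: "\<lbrakk>x \<in> left_inf E; link N n x y\<rbrakk> \<Longrightarrow> link N n y x"
  using link_mono[OF _ link_sym[OF N_arrows]] absorbing unfolding absorbing_def by blast

lemma link_N_antimono:
  assumes "x \<in> left_inf E" "link N n x y" "k \<le> n"
  shows "link N k x y"
  using link_contract[OF N_arrows, of x k "n - k" y N] assms absorbing_res[OF absorbing] by simp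

text \<open>The loss \<open>m\<close> depends on the pool only, not on the level or the paths; all
  composition constants come from here.\<close>

lemma link_into_N:
  assumes "finite S" "S \<subseteq> garrows G"
  obtains m where "\<And>n x y. \<lbrakk>x \<in> left_inf E; link S (n + m) x y\<rbrakk> \<Longrightarrow> link N n x y"
proof -
  obtain m where m: "\<And>g es. \<lbrakk>g \<in> S; is_fpath E (gdom G g) es; m \<le> length es\<rbrakk> \<Longrightarrow> res g es \<in> N"
    using absorbing_finite_set[OF absorbing assms] by blast
  show ?thesis
    by (rule that[of m], erule (1) link_contract[OF assms(2)]) (use m in auto)
qed

text \<open>Links from a finite pool at level \<open>n + m\<close> contract to links from
  \<open>N\<close> at level \<open>n\<close>, so \<open>N\<close> can replace every pool.\<close>

lemma ae_rel_iff_N: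
  "(x, y) \<in> ae_rel E G \<phi> \<longleftrightarrow> x \<in> left_inf E \<and> y \<in> left_inf E \<and> (\<forall>n. link N n x y)"
proof -
  have "link N n x y" if S: "finite S" "S \<subseteq> garrows G" and "\<forall>n. link S n x y" "x \<in> left_inf E" for S n
    using link_into_N[OF S] that by metis
  then have "(\<exists>S. finite S \<and> S \<subseteq> garrows G \<and> (\<forall>n. link S n x y)) \<longleftrightarrow> (\<forall>n. link N n x y)"
    if "x \<in> left_inf E"
    using N_finite N_arrows that by blast
  then show ?thesis unfolding ae_rel_iff by blast
qed

lemma equiv_ae_rel: "equiv (left_inf E) (ae_rel E G \<phi>)"
proof (rule equivI)
  show "ae_rel E G \<phi> \<subseteq> left_inf E \<times> left_inf E" by (auto simp: ae_rel_iff_N)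
  show "refl_on (left_inf E) (ae_rel E G \<phi>)"
    by (auto simp: refl_on_def ae_rel_iff_N link_N_refl)
  show "sym (ae_rel E G \<phi>)"
    using link_N_sym by (auto simp: sym_def ae_rel_iff_N)
  show "trans (ae_rel E G \<phi>)"
  proof (rule transI)
    fix x y z assume "(x, y) \<in> ae_rel E G \<phi>" "(y, z) \<in> ae_rel E G \<phi>"
    then have xyz: "x \<in> left_inf E" "z \<in> left_inf E" "\<And>n. link N n x y" "\<And>n. link N n y z"
      by (auto simp: ae_rel_iff_N)
    \<comment> \<open>Products of \<open>N\<close> with itself leave \<open>N\<close> but still form
      a finite pool, which is all that \<open>ae_rel_iff\<close> requires.\<close>
    then have "link (gmults N N) n x z" for n
      using link_comp[OF N_arrows N_arrows] by blast
    with xyz(1,2) show "(x, z) \<in> ae_rel E G \<phi>"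
      using finite_gmults[OF N_finite N_finite] gmults_closed[OF N_arrows N_arrows]
      unfolding ae_rel_iff by blast
  qed
qed

abbreviation cls :: "(nat \<Rightarrow> 'e) \<Rightarrow> (nat \<Rightarrow> 'e) set" where
  "cls \<equiv> ae_class E G \<phi>"

abbreviation J :: "(nat \<Rightarrow> 'e) set set" where
  "J \<equiv> limit_space E G \<phi>"

lemma cls_eq_iff: "\<lbrakk>x \<in> left_inf E; y \<in> left_inf E\<rbrakk> \<Longrightarrow> cls x = cls y \<longleftrightarrow> (x, y) \<in> ae_rel E G \<phi>"
  using eq_equiv_class_iff[OF equiv_ae_rel] by (simp add: ae_class_def)

lemma cls_image: "cls ` left_inf E = J"
  by (auto simp: limit_space_def ae_class_def quotient_def)

lemma cls_self: "x \<in> left_inf E \<Longrightarrow> x \<in> cls x"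
  using equiv_class_self[OF equiv_ae_rel] by (simp add: ae_class_def)

lemma J_mem:
  assumes "p \<in> J" "x \<in> p"
  shows "x \<in> left_inf E \<and> p = cls x"
proof -
  obtain y where y: "y \<in> left_inf E" "p = cls y" using assms cls_image by blast
  then have "(y, x) \<in> ae_rel E G \<phi>" using assms by (simp add: ae_class_def)
  moreover from this have "x \<in> left_inf E" by (simp add: ae_rel_iff_N)
  ultimately show ?thesis using cls_eq_iff y by simp
qed

lemma J_link: "\<lbrakk>p \<in> J; x \<in> p; y \<in> p\<rbrakk> \<Longrightarrow> link N n x y"
  using J_mem[of p x] ae_rel_iff_N[of x y] unfolding ae_class_def by blast

lemma J_ex: "p \<in> J \<Longrightarrow> \<exists>x\<in>left_inf E. x \<in> p \<and> p = cls x"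
  using cls_image cls_self by blast

text \<open>The induced map on classes; \<open>shift_ae\<close> makes it independent of the chosen
  representative.\<close>

definition lshift :: "(nat \<Rightarrow> 'e) set \<Rightarrow> (nat \<Rightarrow> 'e) set" where
  "lshift p = cls (shift (SOME x. x \<in> p))"

lemma shift_ae: "(x, y) \<in> ae_rel E G \<phi> \<Longrightarrow> (shift x, shift y) \<in> ae_rel E G \<phi>"
  using link_shift[OF N_arrows] by (auto simp: ae_rel_iff_N shift_left_inf)

lemma lshift_cls: "x \<in> left_inf E \<Longrightarrow> lshift (cls x) = cls (shift x)"
proof -
  assume x: "x \<in> left_inf E"
  have "(SOME y. y \<in> cls x) \<in> cls x" using cls_self[OF x] by (rule someI[of "\<lambda>y. y \<in> cls x"])
  then have "(x, SOME y. y \<in> cls x) \<in> ae_rel E G \<phi>" by (simp add: ae_class_def)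
  then have "(shift x, shift (SOME y. y \<in> cls x)) \<in> ae_rel E G \<phi>" by (rule shift_ae)
  moreover from this have "cls (shift x) = cls (shift (SOME y. y \<in> cls x))"
    by (subst cls_eq_iff) (auto simp: ae_rel_iff_N)
  ultimately show ?thesis by (simp add: lshift_def)
qed

lemma shift_mem: "\<lbrakk>p \<in> J; x \<in> p\<rbrakk> \<Longrightarrow> shift x \<in> lshift p"
  using J_mem[of p x] lshift_cls[of x] cls_self[OF shift_left_inf[of x]] by simp

text \<open>At each level \<open>link_extend\<close> attaches some edge to \<open>y\<close>. As
  there are finitely many edges, one of them occurs at infinitely many levels, and
  \<open>link_N_antimono\<close> carries its links down to every level.\<close>

lemma ae_lift:
  assumes x: "x \<in> left_inf E" and ae: "(shift x, y) \<in> ae_rel E G \<phi>"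
  obtains z where "(x, z) \<in> ae_rel E G \<phi>" "shift z = y"
proof -
  have y: "y \<in> left_inf E" using ae by (simp add: ae_rel_iff_N)
  have "\<exists>e. e \<in> arcs E \<and> case_nat e y \<in> left_inf E \<and> link N (Suc n) x (case_nat e y)" for n
  proof -
    have "link N n (shift x) y" using ae by (simp add: ae_rel_iff_N)
    then obtain g where g: "g \<in> N" "gdom G g = head E (shift x n)" "gact g (seg (shift x) n) = seg y n"
      by (auto simp: link_def)
    then have arr: "g \<in> garrows G" using N_arrows by blast
    show ?thesis
      by (rule link_extend[OF x y arr g(2,3)]) (use g in \<open>auto simp: link_def shift_def\<close>)
  qed
  then obtain e where e: "\<And>n. e n \<in> arcs E" "\<And>n. case_nat (e n) y \<in> left_inf E"
    "\<And>n. link N (Suc n) x (case_nat (e n) y)" by metis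
  have "finite (range e)" using finite_subset[of "range e"] e(1) finite_arcs by blast
  then obtain n0 where inf: "infinite {n. e n = e n0}"
    using pigeonhole_infinite[of UNIV e] by auto
  let ?z = "case_nat (e n0) y"
  have "link N n x ?z" for n
  proof -
    obtain k where k: "n < k" "e k = e n0" using inf by (auto simp: infinite_nat_iff_unbounded)
    then have "link N (Suc k) x ?z" using e(3)[of k] by simp
    then show ?thesis using link_N_antimono[OF x] k by simp
  qed
  then show ?thesis using that[of ?z] x e(2) by (simp add: ae_rel_iff_N)
qed

section \<open>The limit space as an expanding system\<close>

definition near :: "nat \<Rightarrow> (nat \<Rightarrow> 'e) set \<Rightarrow> (nat \<Rightarrow> 'e) set \<Rightarrow> bool" where
  "near n p q \<longleftrightarrow> (\<exists>x\<in>p. \<exists>y\<in>q. link N n x y)"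

text \<open>Moving from prescribed representatives to those witnessing \<open>near\<close> costs a
  factor from \<open>N\<close> at either end.\<close>

definition N3 :: "'g set" where
  "N3 = gmults N (gmults N N)"

lemma N3: "finite N3" "N3 \<subseteq> garrows G"
  by (simp_all add: N3_def N_finite N_arrows finite_gmults gmults_closed)

lemma near_link_N3:
  assumes "p \<in> J" "q \<in> J" "near n p q" "x \<in> p" "y \<in> q"
  shows "link N3 n x y"
proof -
  obtain x' y' where xy: "x' \<in> p" "y' \<in> q" "link N n x' y'" using assms(3) by (auto simp: near_def)
  have "x \<in> left_inf E" using J_mem assms by blast
  moreover have "link N n x x'" "link N n y' y"
    using J_link assms xy by blast+
  ultimately have "link (gmults N N) n x y'" "link N n y' y"
    using link_comp[OF N_arrows N_arrows] xy by auto
  then show ?thesis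
    unfolding N3_def
    by (rule link_comp[OF gmults_closed[OF N_arrows N_arrows] N_arrows \<open>x \<in> left_inf E\<close>])
qed

lemma lshift_closed: "p \<in> J \<Longrightarrow> lshift p \<in> J"
  using J_ex lshift_cls cls_image shift_left_inf by (metis image_eqI)

text \<open>Since there are no sources, every left-infinite path can be continued by an edge at its
  right end.\<close>

lemma lshift_surj: "lshift ` J = J"
proof
  show "lshift ` J \<subseteq> J" using lshift_closed by blast
  show "J \<subseteq> lshift ` J"
  proof
    fix p assume "p \<in> J"
    then obtain x where x: "x \<in> left_inf E" "p = cls x" using J_ex by blast
    then have "tail E (x 0) \<in> verts E" by (simp add: left_inf_def)
    then obtain e where "e \<in> arcs E" "head E e = tail E (x 0)"
      using no_sources by (auto simp: no_sources_def)
    then have "case_nat e x \<in> left_inf E" using case_nat_left_inf x by metis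
    then show "p \<in> lshift ` J"
      using lshift_cls x cls_image by (metis image_eqI shift_case_nat)
  qed
qed

text \<open>By \<open>ae_lift\<close>, \<open>shift\<close> maps a class onto its image class, so
  representatives downstairs can be lifted into a given class.\<close>

lemma lshift_fibre:
  assumes "p \<in> J" "y \<in> lshift p"
  obtains x where "x \<in> p" "shift x = y"
proof -
  obtain x where x: "x \<in> left_inf E" "p = cls x" using J_ex assms by blast
  then have "(shift x, y) \<in> ae_rel E G \<phi>" using assms lshift_cls by (simp add: ae_class_def)
  then obtain z where "(x, z) \<in> ae_rel E G \<phi>" "shift z = y" by (rule ae_lift[OF x(1)])
  then show ?thesis using that x by (simp add: ae_class_def)
qed

text \<open>The witness in \<open>lshift p\<close> is lifted into \<open>p\<close>; the linking
  arrow then determines the edge to attach to the witness in \<open>q\<close>, so one level is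
  gained with the same arrow.\<close>

lemma near_lift:
  assumes p: "p \<in> J" and q: "q \<in> J" and near: "near n (lshift p) q"
  shows "\<exists>q'\<in>J. lshift q' = q \<and> near (Suc n) p q'"
proof -
  obtain x' y where x': "x' \<in> lshift p" and y: "y \<in> q" and "link N n x' y"
    using near by (auto simp: near_def)
  obtain x where x: "x \<in> p" "shift x = x'" by (rule lshift_fibre[OF p x'])
  have inf: "x \<in> left_inf E" "y \<in> left_inf E" using J_mem p q x y by auto
  obtain g where g: "g \<in> N" "gdom G g = head E (shift x n)" "gact g (seg (shift x) n) = seg y n"
    using \<open>link N n x' y\<close> x by (auto simp: link_def)
  then have arr: "g \<in> garrows G" using N_arrows by blast
  obtain e where e: "case_nat e y \<in> left_inf E" "gact g (seg x (Suc n)) = seg (case_nat e y) (Suc n)"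
    by (rule link_extend[OF inf arr g(2,3)])
  have "link N (Suc n) x (case_nat e y)" using g e by (auto simp: link_def shift_def)
  then have "near (Suc n) p (cls (case_nat e y))"
    using x cls_self[OF e(1)] by (auto simp: near_def)
  moreover have "lshift (cls (case_nat e y)) = q" using lshift_cls[OF e(1)] J_mem[OF q y] by simp
  ultimately show ?thesis using e(1) cls_image by blast
qed

lemma near_image:
  assumes p: "p \<in> J" and q: "q \<in> J" and near: "near (Suc n) p q"
  shows "near n (lshift p) (lshift q)"
proof -
  obtain x y where x: "x \<in> p" and y: "y \<in> q" and "link N (Suc n) x y"
    using near by (auto simp: near_def)
  have "link N n (shift x) (shift y)"
    using link_shift[OF N_arrows] J_mem[OF p x] \<open>link N (Suc n) x y\<close> by simp
  moreover have "shift x \<in> lshift p" "shift y \<in> lshift q"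
    using shift_mem p q x y by blast+
  ultimately show ?thesis by (auto simp: near_def)
qed

text \<open>Representatives of \<open>p\<close> and \<open>q\<close> with the same shift are linked
  by an arrow of \<open>N3\<close> that fixes their common segment. Beyond the bound from regularity
  its restriction is a unit, so the last edges agree as well.\<close>

lemma lshift_locally_inj: "\<exists>K. \<forall>p\<in>J. \<forall>q\<in>J. near K p q \<and> lshift p = lshift q \<longrightarrow> p = q"
proof -
  have "\<forall>g\<in>N3. \<exists>m. trivial_beyond g m"
    using regular_trivial_beyond[OF finite_arcs regular] N3 by blast
  from bchoice[OF this] obtain m where m: "\<And>g. g \<in> N3 \<Longrightarrow> trivial_beyond g (m g)" by blast
  obtain K where K: "\<And>g. g \<in> N3 \<Longrightarrow> m g \<le> K"
    using finite_nat_set_iff_bounded_le[of "m ` N3"] N3(1) by auto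
  have "p = q" if pq: "p \<in> J" "q \<in> J" and near: "near (Suc K) p q" and eq: "lshift p = lshift q" for p q
  proof -
    obtain x where x: "x \<in> left_inf E" "x \<in> p" "p = cls x" using J_ex pq by blast
    have "shift x \<in> lshift q" using shift_mem[OF pq(1) x(2)] eq by simp
    then obtain y where y: "y \<in> q" "shift y = shift x" by (rule lshift_fibre[OF pq(2)])
    obtain g where g: "g \<in> N3" "gdom G g = head E (x (Suc K))" "gact g (seg x (Suc K)) = seg y (Suc K)"
      using near_link_N3[OF pq near x(2) y(1)] by (auto simp: link_def)
    have arr: "g \<in> garrows G" using g N3 by blast
    \<comment> \<open>The fixed segment has \<open>K + 1\<close> edges, which exceeds every bound
      \<open>m g\<close>; level \<open>Suc K\<close> leaves the last edge for comparison.\<close>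
    let ?s = "seg (shift x) K"
    have path: "is_fpath E (gdom G g) (?s @ [x 0])"
      using is_fpath_seg[OF x(1), of "Suc K"] g by (simp only: seg_shift)
    then have s: "is_fpath E (gdom G g) ?s" "is_fpath E (path_end E (gdom G g) ?s) [x 0]"
      by (simp_all only: is_fpath_append)
    have "gact g ?s @ gact (res g ?s) [x 0] = ?s @ [y 0]"
      using gact_append[OF arr path] g(3) y by (simp only: seg_shift)
    moreover have "length (gact g ?s) = length ?s" by (rule act_path(3)[OF arr s(1)])
    ultimately have fixed: "gact g ?s = ?s" "gact (res g ?s) [x 0] = [y 0]" by simp_all
    then have "res g ?s = gone G (path_end E (gdom G g) ?s)"
      using m[OF g(1)] K[OF g(1)] s(1) by (simp add: trivial_beyond_def)
    then have "x 0 = y 0" using fixed(2) gact_gone[OF s(2)] by simp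
    then have "x i = y i" for i using fun_cong[OF y(2), of "i - 1"] by (cases i) (auto simp: shift_def)
    then have "x = y" by blast
    then show ?thesis using x y J_mem pq by blast
  qed
  then show ?thesis by blast
qed

text \<open>\<open>near_link_N3\<close> lets both links pass through the same representative of
  \<open>q\<close>. The products lie in a finite pool, which \<open>link_into_N\<close> contracts at
  a fixed cost.\<close>

lemma near_comp: "\<exists>m. \<forall>n. \<forall>p\<in>J. \<forall>q\<in>J. \<forall>r\<in>J. near (n + m) p q \<longrightarrow> near (n + m) q r \<longrightarrow> near n p r"
proof -
  obtain m where m: "\<And>n x y. \<lbrakk>x \<in> left_inf E; link (gmults N3 N3) (n + m) x y\<rbrakk> \<Longrightarrow> link N n x y"
    using link_into_N[of "gmults N3 N3"] N3 finite_gmults gmults_closed by metis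
  have "near n p r" if M: "p \<in> J" "q \<in> J" "r \<in> J" and V: "near (n + m) p q" "near (n + m) q r" for n p q r
  proof -
    obtain x y z where xyz: "x \<in> p" "y \<in> q" "z \<in> r" using J_ex M by metis
    then have x: "x \<in> left_inf E" using J_mem M by blast
    have "link (gmults N3 N3) (n + m) x z"
      using link_comp[OF N3(2) N3(2) x] near_link_N3 M V xyz by blast
    then show ?thesis using m[OF x] xyz by (auto simp: near_def)
  qed
  then show ?thesis by blast
qed

text \<open>The witnesses of \<open>near n p q\<close> may vary with \<open>n\<close>. Fixed
  representatives are linked at all levels through the finite pool \<open>N3\<close>, hence
  equivalent.\<close>

lemma near_separated:
  assumes pq: "p \<in> J" "q \<in> J" and near: "\<And>n. near n p q"
  shows "p = q"
proof -
  obtain x y where x: "x \<in> left_inf E" "x \<in> p" "p = cls x" and y: "y \<in> left_inf E" "y \<in> q" "q = cls y"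
    using J_ex pq by metis
  then have "(x, y) \<in> ae_rel E G \<phi>"
    using near_link_N3[OF pq near] N3 by (auto simp: ae_rel_iff)
  then show ?thesis using cls_eq_iff x y by blast
qed

lemma ex_expanding_scale: "\<exists>m K. expanding_scale J near lshift m K"
proof -
  obtain m where m: "\<forall>n. \<forall>p\<in>J. \<forall>q\<in>J. \<forall>r\<in>J. near (n + m) p q \<longrightarrow> near (n + m) q r \<longrightarrow> near n p r"
    using near_comp by blast
  obtain K where K: "\<forall>p\<in>J. \<forall>q\<in>J. near K p q \<and> lshift p = lshift q \<longrightarrow> p = q"
    using lshift_locally_inj by blast
  have "expanding_scale J near lshift m K"
  proof
    show "lshift p \<in> J" if "p \<in> J" for p using that by (rule lshift_closed)
    show "near n p p" if "p \<in> J" for p n using J_ex[OF that] link_N_refl by (auto simp: near_def)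
    show "near n q p" if "p \<in> J" "q \<in> J" "near n p q" for n p q
      using that link_N_sym J_mem by (metis near_def)
    show "near n p q" if "p \<in> J" "q \<in> J" "near (Suc n) p q" for n p q
      using that link_N_antimono[of _ "Suc n" _ n] J_mem by (metis near_def le_SucI order_refl)
    show "near n p r" if "p \<in> J" "q \<in> J" "r \<in> J" "near (n + m) p q" "near (n + m) q r" for n p q r
      using m that by blast
    show "p = q" if "p \<in> J" "q \<in> J" "\<And>n. near n p q" for p q
      using that by (rule near_separated)
    show "near n (lshift p) (lshift q)" if "p \<in> J" "q \<in> J" "near (Suc n) p q" for n p q
      using that by (rule near_image)
    show "\<exists>q'\<in>J. lshift q' = q \<and> near (Suc n) p q'" if "p \<in> J" "q \<in> J" "near n (lshift p) q" for n p q
      using that by (rule near_lift)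
    show "p = q" if "p \<in> J" "q \<in> J" "near K p q" "lshift p = lshift q" for p q
      using K that by blast
  qed
  then show ?thesis by blast
qed

end

section \<open>Topology\<close>

text \<open>Exact scaling gives continuity and injectivity on small balls; the formula for images of
  balls gives openness.\<close>

lemma (in Metric_space) local_homeomorphism_scaling:
  assumes "0 < \<epsilon>" "1 < c" and closed: "\<And>p. p \<in> M \<Longrightarrow> f p \<in> M"
    and scale: "\<And>p q. \<lbrakk>p \<in> M; q \<in> M; d p q < \<epsilon>\<rbrakk> \<Longrightarrow> d (f p) (f q) = c * d p q"
    and ball: "\<And>p \<alpha>. \<lbrakk>p \<in> M; \<alpha> \<le> \<epsilon>\<rbrakk> \<Longrightarrow> f ` mball p \<alpha> = mball (f p) (c * \<alpha>)"
  shows "local_homeomorphism mtopology mtopology f"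
  unfolding local_homeomorphism_def topspace_mtopology
proof
  fix p assume p: "p \<in> M"
  \<comment> \<open>Half of \<epsilon>, so that any two points of the ball are within the range of
    exact scaling.\<close>
  let ?U = "mball p (\<epsilon> / 2)"
  have cont: "continuous_map mtopology mtopology f"
    unfolding continuous_map_to_metric topspace_mtopology
  proof (intro ballI allI impI)
    fix x and e :: real assume x: "x \<in> M" and e: "0 < e"
    let ?r = "min \<epsilon> (e / c)"
    have "f y \<in> mball (f x) e" if "y \<in> mball x ?r" for y
    proof -
      have y: "y \<in> M" "d x y < \<epsilon>" "c * d x y < e" using that assms(2) by (auto simp: field_simps)
      then show ?thesis using scale[of x y] x closed by simp
    qed
    then show "\<exists>U. openin mtopology U \<and> x \<in> U \<and> (\<forall>y\<in>U. f y \<in> mball (f x) e)"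
      using x e assms by (intro exI[of _ "mball x ?r"]) auto
  qed
  have "open_map mtopology mtopology f"
    unfolding open_map_def
  proof (intro allI impI)
    fix U assume U: "openin mtopology U"
    show "openin mtopology (f ` U)"
      unfolding openin_mtopology
    proof (intro conjI allI impI)
      show "f ` U \<subseteq> M" using U closed by (auto simp: openin_mtopology)
    next
      fix y assume "y \<in> f ` U"
      then obtain x where x: "x \<in> U" "y = f x" by blast
      then obtain r where r: "0 < r" "mball x r \<subseteq> U" "x \<in> M" using U unfolding openin_mtopology by blast
      let ?r = "min r \<epsilon>"
      have "mball y (c * ?r) = f ` mball x ?r" using ball[of x ?r] r x by simp
      also have "\<dots> \<subseteq> f ` U" using r mball_subset_concentric[of ?r r x] by (intro image_mono) auto
      finally show "\<exists>r>0. mball y r \<subseteq> f ` U"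
        using r assms by (intro exI[of _ "c * ?r"]) auto
    qed
  qed
  then have U_open: "openin mtopology (f ` ?U)" and U_map: "open_map (subtopology mtopology ?U) mtopology f"
    using open_map_from_subtopology[of mtopology mtopology f ?U] by (auto simp: open_map_def)
  have "inj_on f ?U"
  proof (rule inj_onI)
    fix x y assume xy: "x \<in> ?U" "y \<in> ?U" "f x = f y"
    then have M: "x \<in> M" "y \<in> M" and "d x y < \<epsilon>"
      using triangle[of x p y] commute[of p x] p by auto
    then have "c * d x y = 0" using scale[of x y] closed xy(3) by simp
    then show "x = y" using M assms(2) by simp
  qed
  then have "homeomorphic_map (subtopology mtopology ?U) (subtopology mtopology (f ` ?U)) f"
    using cont U_map closed
    by (intro bijective_open_imp_homeomorphic_map)
      (auto simp: continuous_map_in_subtopology continuous_map_from_subtopology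
        open_map_into_subtopology topspace_subtopology inj_on_def)
  then show "\<exists>U. p \<in> U \<and> openin mtopology U \<and> openin mtopology (f ` U) \<and>
      homeomorphic_map (subtopology mtopology U) (subtopology mtopology (f ` U)) f"
    using p U_open assms(1) by (intro exI[of _ ?U]) auto
qed

text \<open>The left-infinite paths form a closed subset of a product of finite discrete spaces,
  because failure of composability is visible in two adjacent coordinates.\<close>

lemma compact_space_left_topology:
  assumes fin: "finite (arcs E)"
  shows "compact_space (left_topology E)"
proof -
  let ?P = "product_topology (\<lambda>_ :: nat. discrete_topology (arcs E)) UNIV"
  have P: "compact_space ?P"
    using fin by (simp add: compact_space_product_topology compact_space_discrete_topology)
  have top: "topspace ?P = {x. \<forall>i. x i \<in> arcs E}" by auto
  have coord: "openin ?P {x \<in> topspace ?P. x i = a}" for i a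
  proof -
    have "openin ?P {x \<in> topspace ?P. x i \<in> {a} \<inter> arcs E}"
      by (rule openin_continuous_map_preimage[OF continuous_map_product_projection]) auto
    moreover have "{x \<in> topspace ?P. x i \<in> {a} \<inter> arcs E} = {x \<in> topspace ?P. x i = a}"
      unfolding top by auto
    ultimately show ?thesis by simp
  qed
  have "topspace ?P - left_inf E = (\<Union>i. \<Union>(a, b)\<in>{(a, b). tail E a \<noteq> head E b}.
      {x \<in> topspace ?P. x (Suc i) = a} \<inter> {x \<in> topspace ?P. x i = b})"
    unfolding top left_inf_def by fastforce
  moreover have "openin ?P \<dots>"
    by (intro openin_Union) (auto simp del: topspace_product_topology intro!: openin_Int coord openin_Union)
  ultimately have "closedin ?P (left_inf E)"
    unfolding closedin_def top by (auto simp: left_inf_def)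
  then have L: "compactin ?P (left_inf E)" by (rule closedin_compact_space[OF P])
  have sub: "left_inf E \<subseteq> topspace ?P" unfolding top by (auto simp: left_inf_def)
  have top_sub: "topspace (subtopology ?P (left_inf E)) = left_inf E"
    using sub by (simp only: topspace_subtopology inf.absorb2)
  have cylinder: "openin (subtopology ?P (left_inf E)) (left_cylinder E x n)" for x n
  proof (induction n)
    case 0
    have "left_cylinder E x 0 = left_inf E" by (simp add: left_cylinder_def)
    then show ?case using openin_topspace[of "subtopology ?P (left_inf E)"] top_sub by metis
  next
    case (Suc n)
    have eq: "left_cylinder E x (Suc n) =
        left_cylinder E x n \<inter> ({y \<in> topspace ?P. y n = x n} \<inter> left_inf E)"
      using sub by (auto simp: left_cylinder_def less_Suc_eq)
    show ?case unfolding eq by (rule openin_Int[OF Suc openin_subtopology_Int[OF coord]])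
  qed
  \<comment> \<open>Cylinders are open in the product, so the identity carries compactness over to
    \<open>left_topology E\<close>.\<close>
  have "continuous_map (subtopology ?P (left_inf E)) (left_topology E) (\<lambda>x. x)"
    unfolding left_topology_def
  proof (intro continuous_on_generated_topo)
    fix U assume "U \<in> {left_cylinder E x n |x n. x \<in> left_inf E}"
    then have "openin (subtopology ?P (left_inf E)) U" using cylinder by blast
    then have "openin (subtopology ?P (left_inf E)) (U \<inter> topspace (subtopology ?P (left_inf E)))"
      by (rule openin_Int[OF _ openin_topspace])
    then show "openin (subtopology ?P (left_inf E))
        ((\<lambda>x. x) -` U \<inter> topspace (subtopology ?P (left_inf E)))"
      by (simp only: vimage_def Collect_mem_eq)
  next
    show "(\<lambda>x. x) ` topspace (subtopology ?P (left_inf E)) \<subseteq> \<Union> {left_cylinder E x n |x n. x \<in> left_inf E}"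
      unfolding top_sub by (auto simp: left_cylinder_def)
  qed
  then have "compactin (left_topology E) ((\<lambda>x. x) ` left_inf E)"
    using L by (intro image_compactin) (auto simp: compactin_subtopology)
  then show ?thesis by (simp add: compact_space_def topspace_left_topology)
qed

context contracting_action
begin

text \<open>A continuous surjection from a compact space onto a Hausdorff space is a quotient map.
  Thus \<open>cls\<close> is one for both topologies, which therefore coincide.\<close>

lemma mtopology_eq_limit_topology:
  assumes D: "Metric_space J D"
    and small: "\<And>e. 0 < e \<Longrightarrow> \<exists>n. \<forall>p\<in>J. \<forall>q\<in>J. near n p q \<longrightarrow> D p q < e"
  shows "Metric_space.mtopology J D = limit_topology E G \<phi>"
proof -
  interpret D: Metric_space J D by fact
  have "continuous_map (left_topology E) D.mtopology cls"
    unfolding D.continuous_map_to_metric topspace_left_topology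
  proof (intro ballI allI impI)
    fix x and e :: real assume x: "x \<in> left_inf E" and e: "0 < e"
    obtain n where n: "\<And>p q. \<lbrakk>p \<in> J; q \<in> J; near n p q\<rbrakk> \<Longrightarrow> D p q < e" using small[OF e] by blast
    \<comment> \<open>The cylinder fixes the \<open>Suc n\<close> edges of \<open>seg x n\<close>,
      so an arrow linking \<open>x\<close> to itself at level \<open>n\<close> also links
      \<open>x\<close> to \<open>y\<close>.\<close>
    have "cls y \<in> D.mball (cls x) e" if y: "y \<in> left_cylinder E x (Suc n)" for y
    proof -
      have "y \<in> left_inf E" and "seg x n = seg y n"
        using y by (auto simp: left_cylinder_def seg_eq_iff less_Suc_eq_le)
      moreover have "link N n x y"
        using link_N_refl[OF x, of n] calculation by (simp add: link_def)
      ultimately have "near n (cls x) (cls y)"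
        using cls_self x by (auto simp: near_def)
      then show ?thesis using n cls_image x \<open>y \<in> left_inf E\<close> by (auto simp: D.in_mball)
    qed
    moreover have "openin (left_topology E) (left_cylinder E x (Suc n))"
      unfolding left_topology_def using x by (intro topology_generated_by_Basis) blast
    moreover have "x \<in> left_cylinder E x (Suc n)" using x by (simp add: left_cylinder_def)
    ultimately show "\<exists>U. openin (left_topology E) U \<and> x \<in> U \<and> (\<forall>y\<in>U. cls y \<in> D.mball (cls x) e)"
      by blast
  qed
  then have "quotient_map (left_topology E) D.mtopology cls"
    by (rule T1_Spaces.continuous_imp_quotient_map)
      (simp_all add: compact_space_left_topology finite_arcs D.Hausdorff_space_mtopology
        topspace_left_topology cls_image)
  then have "openin D.mtopology U \<longleftrightarrow>
      U \<subseteq> J \<and> openin (left_topology E) {x \<in> left_inf E. cls x \<in> U}" for U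
    using openin_subset[of D.mtopology U]
    unfolding quotient_map_def D.topspace_mtopology topspace_left_topology by blast
  then show ?thesis by (simp add: topology_eq openin_limit_topology)
qed

end

theorem theorem4p3:
  fixes E :: "('v, 'e) pre_digraph"
    and G :: "('v, 'g) groupoid"
    and \<phi> :: "'g \<Rightarrow> ('v, 'e) piso"
  assumes "fin_digraph E"
    and "no_sources E"
    and "self_similar_action E G \<phi>"
    and "contracting E G \<phi>"
    and "regular E G \<phi>"
  shows "\<exists>\<sigma> :: (nat \<Rightarrow> 'e) set \<Rightarrow> (nat \<Rightarrow> 'e) set.
    \<sigma> ` limit_space E G \<phi> = limit_space E G \<phi> \<and>
    (\<forall>x\<in>left_inf E. \<sigma> (ae_class E G \<phi> x) = ae_class E G \<phi> (shift x)) \<and>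
    (\<exists>\<epsilon>>0. \<exists>c>1. \<exists>d.
       Metric_space (limit_space E G \<phi>) d \<and>
       Metric_space.mtopology (limit_space E G \<phi>) d = limit_topology E G \<phi> \<and>
       (\<forall>p\<in>limit_space E G \<phi>. \<forall>q\<in>limit_space E G \<phi>. d p q < \<epsilon> \<longrightarrow> d (\<sigma> p) (\<sigma> q) = c * d p q) \<and>
       (\<forall>\<alpha>. \<forall>p\<in>limit_space E G \<phi>. 0 < \<alpha> \<and> \<alpha> \<le> \<epsilon> \<longrightarrow>
          \<sigma> ` Metric_space.mball (limit_space E G \<phi>) d p \<alpha> = Metric_space.mball (limit_space E G \<phi>) d (\<sigma> p) (c * \<alpha>)) \<and>
       locally_expanding (limit_space E G \<phi>) d \<sigma>) \<and>
    local_homeomorphism (limit_topology E G \<phi>) (limit_topology E G \<phi>) \<sigma>"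
proof -
  interpret fin_digraph E by fact
  interpret self_similar_action E G \<phi> by fact
  obtain N where "absorbing N"
    using ex_absorbing[OF finite_verts finite_arcs assms(4)] .
  then interpret contracting_action E G \<phi> N
    by unfold_locales (use assms(2,5) in auto)
  obtain m K where "expanding_scale J near lshift m K" using ex_expanding_scale by blast
  then interpret expanding_scale J near lshift m K .
  obtain \<epsilon> c :: real and D where \<epsilon>: "0 < \<epsilon>" and c: "1 < c" and D: "Metric_space J D"
    and scale: "\<And>p q. \<lbrakk>p \<in> J; q \<in> J; D p q < \<epsilon>\<rbrakk> \<Longrightarrow> D (lshift p) (lshift q) = c * D p q"
    and ball: "\<And>p \<alpha>. \<lbrakk>p \<in> J; \<alpha> \<le> \<epsilon>\<rbrakk>
      \<Longrightarrow> lshift ` Metric_space.mball J D p \<alpha> = Metric_space.mball J D (lshift p) (c * \<alpha>)"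
    and small: "\<And>e. 0 < e \<Longrightarrow> \<exists>n. \<forall>p\<in>J. \<forall>q\<in>J. near n p q \<longrightarrow> D p q < e"
    by (rule self_similar_metric) blast
  have top: "Metric_space.mtopology J D = limit_topology E G \<phi>"
    using D small by (rule mtopology_eq_limit_topology)
  have expanding: "locally_expanding J D lshift"
    unfolding locally_expanding_def using \<epsilon> c scale by (metis order_refl)
  \<comment> \<open>The statement for the metric topology is transported along
    \<open>top\<close>.\<close>
  have homeo: "local_homeomorphism (limit_topology E G \<phi>) (limit_topology E G \<phi>) lshift"
    using Metric_space.local_homeomorphism_scaling[OF D \<epsilon> c lshift_closed scale ball] by (simp add: top)
  show ?thesis
    by (rule exI[of _ lshift], intro conjI ballI, fact lshift_surj, erule lshift_cls,
        rule exI[of _ \<epsilon>], rule conjI, fact \<epsilon>, rule exI[of _ c], rule conjI, fact c,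
        rule exI[of _ D]) (simp_all add: D top scale ball expanding homeo)
qed

end
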